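(* Let $\gamma_1,\gamma_2,\nu_1,\nu_2,\lambda,\mu,\beta_1,\beta_2$ be smooth functions on a domain $\mathcal{D}\subset\mathbb{R}^2$ (coordinates $(u,v)$) such that $$\frac{\mu_u}{2\mu\gamma_2+\nu_1\beta_2-\lambda\beta_1}>0,\qquad \frac{\mu_v}{2\mu\gamma_1-\lambda\beta_2+\nu_2\beta_1}>0,$$ and, defining the positive functions $\sqrt{E}:=\frac{\mu_u}{2\mu\gamma_2+\nu_1\beta_2-\lambda\beta_1}$ and $\sqrt{G}:=\frac{\mu_v}{2\mu\gamma_1-\lambda\beta_2+\nu_2\beta_1}$, the following equalities hold on $\mathcal{D}$: $$-\gamma_1\sqrt{E}\sqrt{G}=(\sqrt{E})_v,\qquad -\gamma_2\sqrt{E}\sqrt{G}=(\sqrt{G})_u,$$ $$\nu_1\nu_2-(\lambda^2+\mu^2)=\tfrac{1}{\sqrt{E}}(\gamma_2)_u+\tfrac{1}{\sqrt{G}}(\gamma_1)_v-(\gamma_1^2+\gamma_2^2),$$ $$2\lambda\gamma_2+\mu\beta_1-(\nu_1-\nu_2)\gamma_1=\tfrac{1}{\sqrt{E}}\lambda_u-\tfrac{1}{\sqrt{G}}(\nu_1)_v,$$ $$2\lambda\gamma_1+\mu\beta_2+(\nu_1-\nu_2)\gamma_2=-\tfrac{1}{\sqrt{E}}(\nu_2)_u+\tfrac{1}{\sqrt{G}}\lambda_v,$$ $$\gamma_1\beta_1-\gamma_2\beta_2+(\nu_1-\nu_2)\mu=-\tfrac{1}{\sqrt{E}}(\beta_2)_u+\tfrac{1}{\sqrt{G}}(\beta_1)_v.$$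 Let $(u_0,v_0)\in\mathcal{D}$, let $p_0\in\mathbb{R}^4$, and let $x_0,y_0,b_0,l_0$ be an orthonormal frame at $p_0$. Then there exist a subdomain $\mathcal{D}_0\subset\mathcal{D}$ containing $(u_0,v_0)$ and a unique surface $M^2: z=z(u,v)$, $(u,v)\in\mathcal{D}_0$, with $z(u_0,v_0)=p_0$, such that $\gamma_1,\gamma_2,\nu_1,\nu_2,\lambda,\mu,\beta_1,\beta_2$ are the geometric functions of $M^2$ and $x_0,y_0,b_0,l_0$ is the geometric frame of $M^2$ at $p_0$; that is, $\langle z_u,z_u\rangle=E$, $\langle z_u,z_v\rangle=0$, $\langle z_v,z_v\rangle=G$, and there is an orthonormal frame field $\{x,y,b,l\}$ along $M^2$ with $x=z_u/\sqrt{E}$, $y=z_v/\sqrt{G}$, $b,l$ normal to $M^2$, $(x,y,b,l)(u_0,v_0)=(x_0,y_0,b_0,l_0)$, satisfying $$\begin{aligned} &\nabla'_xx=\gamma_1y+\nu_1b, && \nabla'_xb=-\nu_1x-\lambda y+\beta_1l,\\ &\nabla'_xy=-\gamma_1x+\lambda b+\mu l, && \nabla'_yb=-\lambda x-\nu_2y+\beta_2l,\\ &\nabla'_yx=-\gamma_2y+\lambda b+\mu l, && \nabla'_xl=-\mu y-\beta_1b,\\ &\nabla'_yy=\gamma_2x+\nu_2b, && \nabla'_yl=-\mu x-\beta_2b. \end{aligned}$$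
   Context: $\nabla'$ denotes the flat Levi-Civita connection (directional derivative) of $\mathbb{R}^4$; for a vector function $w(u,v)$ along the surface, $\nabla'_xw=\frac{1}{\sqrt{E}}w_u$ and $\nabla'_yw=\frac{1}{\sqrt{G}}w_v$. Background (for orientation only): for a surface in $\mathbb{R}^4$ with $\varkappa^2-k>0$ parametrized by principal lines ($F=M=0$ in the paper's notation), the geometric frame $\{x,y,b,l\}$ consists of the unit tangent vectors $x=z_u/\sqrt{E}$, $y=z_v/\sqrt{G}$, a unit normal $b$ collinear with $\sigma(x,x)$ and $\sigma(y,y)$, and a unit normal $l$ completing a positively oriented orthonormal frame; the geometric functions are the coefficients $\gamma_1,\gamma_2,\nu_1,\nu_2,\lambda,\mu,\beta_1,\beta_2$ in the Frenet-type formulas displayed in the claim. *)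

theory Defs
  imports "HOL-Analysis.Analysis"
begin

definition pu :: "(real \<times> real \<Rightarrow> 'a::real_normed_vector) \<Rightarrow> real \<times> real \<Rightarrow> 'a" where
  "pu f = (\<lambda>(u,v). vector_derivative (\<lambda>t. f (t, v)) (at u))"

definition pv :: "(real \<times> real \<Rightarrow> 'a::real_normed_vector) \<Rightarrow> real \<times> real \<Rightarrow> 'a" where
  "pv f = (\<lambda>(u,v). vector_derivative (\<lambda>t. f (u, t)) (at v))"

fun Ck_on :: "nat \<Rightarrow> (real \<times> real) set \<Rightarrow> (real \<times> real \<Rightarrow> 'a::real_normed_vector) \<Rightarrow> bool" where
  "Ck_on 0 S f = continuous_on S f"
| "Ck_on (Suc k) S f =
     (continuous_on S f \<and>
      (\<forall>(u,v)\<in>S. (\<lambda>t. f (t, v)) differentiable (at u) \<and> (\<lambda>t. f (u, t)) differentiable (at v)) \<and>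
      Ck_on k S (pu f) \<and> Ck_on k S (pv f))"

definition smooth_on :: "(real \<times> real) set \<Rightarrow> (real \<times> real \<Rightarrow> 'a::real_normed_vector) \<Rightarrow> bool" where
  "smooth_on S f \<longleftrightarrow> (\<forall>k. Ck_on k S f)"

definition orthonormal4 :: "real^4 \<Rightarrow> real^4 \<Rightarrow> real^4 \<Rightarrow> real^4 \<Rightarrow> bool" where
  "orthonormal4 a b c d \<longleftrightarrow>
     a \<bullet> a = 1 \<and> b \<bullet> b = 1 \<and> c \<bullet> c = 1 \<and> d \<bullet> d = 1 \<and>
     a \<bullet> b = 0 \<and> a \<bullet> c = 0 \<and> a \<bullet> d = 0 \<and> b \<bullet> c = 0 \<and> b \<bullet> d = 0 \<and> c \<bullet> d = 0"

end

theory Submission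
  imports Defs
begin

text \<open>The surface and its frame, F = (z, x, y, b, l), solve a linear Pfaffian system
  F_u = A F, F_v = B F. The hypotheses of the theorem (including the definitions of sE and sG, which
  are the l-components of the equations for x and y) are exactly the compatibility condition
  A_v + A B = B_u + B A. On a small square the integral equation obtained by integrating
  F_v = B F along the line u = u0 and then F_u = A F along the lines v = const has a continuous solution by the
  contraction principle, and compatibility forces F_v = B F everywhere. The part of the system acting on
  (x, y, b, l) is skew-symmetric, so the defect of the Gram matrix and the squared distance
  between two solutions are constant; hence the frame stays orthonormal and is unique, and z is
  determined by z_u = sE x, z_v = sG y.\<close>

text \<open>The textbook argument for the v-equation differentiates the defect
  \<open>W_v - Q W\<close> in u. A fixed point of the integral equation does not allow this: it is
  only known to be continuous, to have a u-derivative everywhere, and to have a v-derivative on the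
  line through the base point. The comparison is therefore made between integrated equations, and
  the defect is killed by the same smallness of the square that makes the integral operator a
  contraction. For this step the coefficients are bounded operators on a Banach space, which keeps
  indices out of the estimates; matrices reappear afterwards. Smoothness is recovered at the end,
  since a continuous solution of a linear system with smooth coefficients gains one derivative each
  time the equations are applied to it. A square is a convenient domain because any two of its
  points are joined by one horizontal and one vertical segment, so a quantity with vanishing partial
  derivatives is constant; orthonormality and uniqueness both rest on this.\<close>

section \<open>Compatible linear systems\<close>

text \<open>The integral from c to x, parametrized over the unit interval so that it is also correct for x < c,
  where the library integral over the interval from c to x vanishes.\<close>

definition seg_int :: "real \<Rightarrow> real \<Rightarrow> (real \<Rightarrow> 'w::banach) \<Rightarrow> 'w" where
  "seg_int c x f = integral {0..1} (\<lambda>t. (x - c) *\<^sub>R f (c + t * (x - c)))"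

section \<open>Integrals along an oriented segment\<close>

lemma seg_int_self [simp]: "seg_int c c f = 0"
  by (simp add: seg_int_def)

lemma seg_point_mem:
  fixes c x :: real
  assumes "c \<in> {a..b}" "x \<in> {a..b}" "t \<in> {0..1}"
  shows "c + t * (x - c) \<in> {a..b}"
  using convexD_alt[OF convex_real_interval(5)[of a b] assms(1,2), of t] assms(3)
  by (simp add: algebra_simps)

lemma seg_int_cong:
  assumes "c \<in> {a..b}" "x \<in> {a..b}" "\<And>s. s \<in> {a..b} \<Longrightarrow> f s = g s"
  shows "seg_int c x f = seg_int c x g"
  unfolding seg_int_def using assms(3) seg_point_mem[OF assms(1,2)]
  by (intro integral_cong) presburger

lemma seg_int_integrand_continuous:
  fixes f :: "real \<Rightarrow> 'w::real_normed_vector"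
  assumes "continuous_on {a..b} f" "c \<in> {a..b}" "x \<in> {a..b}"
  shows "continuous_on {0..1} (\<lambda>t. (x - c) *\<^sub>R f (c + t * (x - c)))"
proof -
  have "continuous_on {0..1} (\<lambda>t. f (c + t * (x - c)))"
    using seg_point_mem[OF assms(2,3)]
    by (intro continuous_on_compose2[OF assms(1)] continuous_intros image_subsetI)
  then show ?thesis by (intro continuous_intros)
qed

lemma seg_int_diff:
  assumes "continuous_on {a..b} f" "continuous_on {a..b} g" "c \<in> {a..b}" "x \<in> {a..b}"
  shows "seg_int c x (\<lambda>s. f s - g s) = seg_int c x f - seg_int c x g"
proof -
  note ints = seg_int_integrand_continuous[OF assms(1,3,4)] seg_int_integrand_continuous[OF assms(2-4)]
  then show ?thesis
    unfolding seg_int_def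
    by (simp add: scaleR_diff_right integral_diff integrable_continuous_real)
qed

lemma norm_seg_int_le:
  assumes f: "continuous_on {a..b} f" and c: "c \<in> {a..b}" and x: "x \<in> {a..b}"
    and B: "\<And>s. s \<in> {a..b} \<Longrightarrow> norm (f s) \<le> B"
  shows "norm (seg_int c x f) \<le> \<bar>x - c\<bar> * B"
proof -
  have "norm (seg_int c x f) \<le> \<bar>x - c\<bar> * B * (1 - 0)"
    unfolding seg_int_def
    by (rule integral_bound)
      (auto intro!: seg_int_integrand_continuous[OF f c x] mult_left_mono B seg_point_mem[OF c x, simplified])
  then show ?thesis by simp
qed

lemma norm_seg_int_diff_le:
  assumes "continuous_on {a..b} f" "continuous_on {a..b} g" "c \<in> {a..b}" "x \<in> {a..b}"
    and "\<And>s. s \<in> {a..b} \<Longrightarrow> norm (f s - g s) \<le> B"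
  shows "norm (seg_int c x f - seg_int c x g) \<le> \<bar>x - c\<bar> * B"
  unfolding seg_int_diff[OF assms(1-4), symmetric]
  using assms by (intro norm_seg_int_le[of a b] continuous_intros) auto

lemma continuous_on_seg_int:
  assumes F: "continuous_on (V \<times> {a..b}) (\<lambda>(p, s). F p s)"
    and c: "c \<in> {a..b}" and h: "continuous_on V h" and mem: "\<And>p. p \<in> V \<Longrightarrow> h p \<in> {a..b}"
  shows "continuous_on V (\<lambda>p. seg_int c (h p) (F p))"
proof -
  have "continuous_on (V \<times> cbox 0 1) (\<lambda>(p, t). (h p - c) *\<^sub>R F p (c + t * (h p - c)))"
  proof -
    have h': "continuous_on (V \<times> cbox 0 1) (\<lambda>q. h (fst q))"
      by (rule continuous_on_compose2[OF h]) (auto intro!: continuous_intros)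
    have "continuous_on (V \<times> cbox 0 1) (\<lambda>q. (\<lambda>(p, s). F p s) (fst q, c + snd q * (h (fst q) - c)))"
      using seg_point_mem[OF c mem]
      by (intro continuous_on_compose2[OF F] continuous_intros h') auto
    then show ?thesis
      unfolding case_prod_beta by (intro continuous_intros h') simp
  qed
  from integral_continuous_on_param[OF this] show ?thesis
    by (simp add: seg_int_def)
qed

lemma seg_int_FTC:
  assumes g: "\<And>s. s \<in> {a..b} \<Longrightarrow> (g has_vector_derivative f s) (at s within {a..b})"
    and c: "c \<in> {a..b}" and x: "x \<in> {a..b}"
  shows "seg_int c x f = g x - g c"
proof -
  let ?h = "\<lambda>t. c + t * (x - c)"
  have "((\<lambda>t. (x - c) *\<^sub>R f (?h t)) has_integral ((g \<circ> ?h) 1 - (g \<circ> ?h) 0)) {0..1}"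
  proof (rule fundamental_theorem_of_calculus)
    fix t :: real assume t: "t \<in> {0..1}"
    have sub: "?h ` {0..1} \<subseteq> {a..b}" using seg_point_mem[OF c x] by auto
    show "((g \<circ> ?h) has_vector_derivative (x - c) *\<^sub>R f (?h t)) (at t within {0..1})"
      by (rule vector_diff_chain_within)
        (auto intro!: derivative_eq_intros has_vector_derivative_within_subset[OF g[OF seg_point_mem[OF c x t]] sub])
  qed simp
  from integral_unique[OF this] show ?thesis unfolding seg_int_def by simp
qed

text \<open>Differentiating the rescaled integrand in the endpoint would require a derivative of
  \<open>f\<close>. Instead an antiderivative of the continuous function \<open>f\<close> is chosen;
  the integral is its increment, and the derivative is read off.\<close>

lemma seg_int_has_vector_derivative:
  assumes f: "continuous_on {a..b} f" and c: "c \<in> {a..b}" and x: "x \<in> {a..b}"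
  shows "((\<lambda>x. seg_int c x f) has_vector_derivative f x) (at x within {a..b})"
proof -
  obtain g where g: "\<And>s. s \<in> {a..b} \<Longrightarrow> (g has_vector_derivative f s) (at s within {a..b})"
    using antiderivative_continuous[OF f] by blast
  have "((\<lambda>x. g x - g c) has_vector_derivative f x) (at x within {a..b})"
    by (auto intro!: derivative_eq_intros g x)
  then show ?thesis
    by (rule has_vector_derivative_transform[rotated 2]) (use seg_int_FTC[OF g c] x in auto)
qed

text \<open>The rescaling fixes the interval of integration at \<open>{0..1}\<close>, so the Leibniz
  rule for a compact interval applies also when \<open>x < c\<close>. This serves to differentiate
  in u an integral taken in v.\<close>

lemma seg_int_leibniz:
  fixes F :: "real \<Rightarrow> real \<Rightarrow> 'w::banach"
  assumes F: "\<And>u s. u \<in> U \<Longrightarrow> s \<in> {a..b} \<Longrightarrow> ((\<lambda>u. F u s) has_vector_derivative Fu u s) (at u within U)"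
    and cF: "\<And>u. u \<in> U \<Longrightarrow> continuous_on {a..b} (F u)"
    and cFu: "continuous_on (U \<times> {a..b}) (\<lambda>(u, s). Fu u s)"
    and U: "u \<in> U" "convex U" and c: "c \<in> {a..b}" and x: "x \<in> {a..b}"
  shows "((\<lambda>u. seg_int c x (F u)) has_vector_derivative seg_int c x (Fu u)) (at u within U)"
proof -
  note mem = seg_point_mem[OF c x]
  have "continuous_on (U \<times> cbox 0 1) (\<lambda>q. (\<lambda>(u, s). Fu u s) (fst q, c + snd q * (x - c)))"
    using mem by (intro continuous_on_compose2[OF cFu] continuous_intros) auto
  then have "continuous_on (U \<times> cbox 0 1) (\<lambda>(u, t). (x - c) *\<^sub>R Fu u (c + t * (x - c)))"
    unfolding case_prod_beta by (intro continuous_intros) simp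
  moreover have "((\<lambda>u. (x - c) *\<^sub>R F u (c + t * (x - c))) has_vector_derivative
      (x - c) *\<^sub>R Fu u (c + t * (x - c))) (at u within U)" if "u \<in> U" "t \<in> cbox 0 1" for u t
    using that mem by (auto intro!: derivative_eq_intros F)
  moreover have "(\<lambda>t. (x - c) *\<^sub>R F u (c + t * (x - c))) integrable_on cbox 0 1" if "u \<in> U" for u
    using integrable_continuous_real[OF seg_int_integrand_continuous[OF cF[OF that] c x]] by simp
  ultimately show ?thesis
    unfolding seg_int_def box_real(2)[symmetric] by (intro leibniz_rule_vector_derivative U) auto
qed

text \<open>Bounded continuous functions on the whole space form a complete metric space, so the
  fixed point is sought there: \<open>T\<close> is applied and its result is extended from the box
  by precomposition with \<open>clamp\<close>. Every value of the extension is a value on the box,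
  so the pointwise estimate, with \<open>M\<close> the sup distance, bounds the distance
  everywhere.\<close>

lemma contraction_on_cbox:
  fixes T :: "('a::euclidean_space \<Rightarrow> 'w::banach) \<Rightarrow> 'a \<Rightarrow> 'w"
  assumes cont: "\<And>f. continuous_on (cbox a b) f \<Longrightarrow> continuous_on (cbox a b) (T f)"
    and contr: "\<And>f g M p. continuous_on (cbox a b) f \<Longrightarrow> continuous_on (cbox a b) g \<Longrightarrow>
        (\<And>q. q \<in> cbox a b \<Longrightarrow> norm (f q - g q) \<le> M) \<Longrightarrow> p \<in> cbox a b \<Longrightarrow>
        norm (T f p - T g p) \<le> k * M"
    and k: "0 \<le> k" "k < 1" and ne: "cbox a b \<noteq> {}"
  shows "\<exists>f. continuous_on (cbox a b) f \<and> (\<forall>p\<in>cbox a b. T f p = f p)"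
proof -
  have "\<exists>h. (\<forall>x\<in>cbox a b. apply_bcontfun h x = T (apply_bcontfun g) x) \<and>
      (\<forall>x. apply_bcontfun h x = T (apply_bcontfun g) (clamp a b x))" for g
    using continuous_on_cbox_bcontfunE[OF cont[OF continuous_on_apply_bcontfun[of _ g]]] by metis
  then obtain \<Phi> where
    \<Phi>: "\<And>g x. x \<in> cbox a b \<Longrightarrow> apply_bcontfun (\<Phi> g) x = T (apply_bcontfun g) x"
      "\<And>g x. apply_bcontfun (\<Phi> g) x = T (apply_bcontfun g) (clamp a b x)"
    by metis
  have "dist (\<Phi> f) (\<Phi> g) \<le> k * dist f g" for f g
  proof (rule dist_bound)
    fix x
    have "clamp a b x \<in> cbox a b"
      using ne by (intro clamp_in_interval) (simp add: box_ne_empty)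
    then show "dist (apply_bcontfun (\<Phi> f) x) (apply_bcontfun (\<Phi> g) x) \<le> k * dist f g"
      unfolding \<Phi>(2) dist_norm
      using dist_bounded[of f _ g] by (intro contr) (auto simp: dist_norm)
  qed
  with Banach_fix[OF complete_UNIV _ k, of \<Phi>] obtain f where "\<Phi> f = f" by auto
  with \<Phi>(1)[of _ f] show ?thesis
    using continuous_on_apply_bcontfun by metis
qed

section \<open>Local solutions of a compatible operator equation\<close>

lemma closed_square_in_open:
  fixes D :: "(real \<times> real) set"
  assumes "open D" "(c, d) \<in> D"
  obtains R where "R > 0" "{c - R..c + R} \<times> {d - R..d + R} \<subseteq> D"
proof -
  from assms obtain A B where "open A" "open B" "c \<in> A" "d \<in> B" "A \<times> B \<subseteq> D"
    by (metis open_prod_elim mem_Sigma_iff)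
  moreover from this obtain e1 e2 where "e1 > 0" "cball c e1 \<subseteq> A" "e2 > 0" "cball d e2 \<subseteq> B"
    by (metis open_contains_cball)
  ultimately show ?thesis
    by (intro that[of "min e1 e2"]) (force simp: cball_eq_atLeastAtMost)+
qed

lemma norm_diff_le_of_vector_derivative_bound:
  fixes f :: "real \<Rightarrow> 'w::real_normed_vector"
  assumes f: "\<And>s. s \<in> {a..b} \<Longrightarrow> (f has_vector_derivative f' s) (at s within {a..b})"
    and B: "\<And>s. s \<in> {a..b} \<Longrightarrow> norm (f' s) \<le> B"
    and "x \<in> {a..b}" "c \<in> {a..b}"
  shows "norm (f x - f c) \<le> B * \<bar>x - c\<bar>"
proof -
  have "norm (f x - f c) \<le> B * norm (x - c)"
  proof (rule differentiable_bound[of "{a..b}" f "\<lambda>s h. h *\<^sub>R f' s"])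
    fix s assume "s \<in> {a..b}"
    then show "onorm (\<lambda>h. h *\<^sub>R f' s) \<le> B"
      using B[of s] by (intro onorm_le) (simp add: mult_left_mono mult.commute[of B])
  qed (use assms in \<open>auto simp: has_vector_derivative_def\<close>)
  then show ?thesis by simp
qed

text \<open>\<open>P'\<close> and \<open>Q'\<close> are the cross derivatives \<open>P_v\<close> and
  \<open>Q_u\<close>, and \<open>compat\<close> equates the two mixed derivatives of a solution. The
  estimates are made on a compact square; the conclusion is for its interior, where both partial
  derivatives are two-sided.\<close>

lemma linear_pfaffian_local:
  fixes P Q P' Q' :: "real \<times> real \<Rightarrow> 'w::banach \<Rightarrow>\<^sub>L 'w" and w0 :: 'w
  assumes D: "open D" "(c, d) \<in> D"
    and cont: "continuous_on D P" "continuous_on D Q" "continuous_on D P'" "continuous_on D Q'"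
    and P': "\<And>u v. (u, v) \<in> D \<Longrightarrow> ((\<lambda>v. P (u, v)) has_vector_derivative P' (u, v)) (at v)"
    and Q': "\<And>u v. (u, v) \<in> D \<Longrightarrow> ((\<lambda>u. Q (u, v)) has_vector_derivative Q' (u, v)) (at u)"
    and compat: "\<And>p w. p \<in> D \<Longrightarrow> P' p w + P p (Q p w) = Q' p w + Q p (P p w)"
  obtains r W where "r > 0" "{c - r<..<c + r} \<times> {d - r<..<d + r} \<subseteq> D" "W (c, d) = w0"
    "continuous_on ({c - r<..<c + r} \<times> {d - r<..<d + r}) W"
    "\<And>u v. (u, v) \<in> {c - r<..<c + r} \<times> {d - r<..<d + r} \<Longrightarrow>
       ((\<lambda>u. W (u, v)) has_vector_derivative P (u, v) (W (u, v))) (at u)"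
    "\<And>u v. (u, v) \<in> {c - r<..<c + r} \<times> {d - r<..<d + r} \<Longrightarrow>
       ((\<lambda>v. W (u, v)) has_vector_derivative Q (u, v) (W (u, v))) (at v)"
proof -
  obtain R where R: "R > 0" "{c - R..c + R} \<times> {d - R..d + R} \<subseteq> D"
    using closed_square_in_open[OF D] by blast
  let ?B = "{c - R..c + R} \<times> {d - R..d + R}"
  have "bounded (P ` ?B)" "bounded (Q ` ?B)" "bounded (P' ` ?B)"
    by (intro compact_imp_bounded compact_continuous_image continuous_on_subset[OF cont(1) R(2)]
        continuous_on_subset[OF cont(2) R(2)] continuous_on_subset[OF cont(3) R(2)] compact_Times compact_Icc)+
  then have "bounded (P ` ?B \<union> Q ` ?B \<union> P' ` ?B)" by simp
  then obtain K where "K > 0" "\<And>F. F \<in> P ` ?B \<union> Q ` ?B \<union> P' ` ?B \<Longrightarrow> norm F \<le> K"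
    unfolding bounded_pos by blast
  then have K: "K > 0" "\<And>p. p \<in> ?B \<Longrightarrow> norm (P p) \<le> K"
    "\<And>p. p \<in> ?B \<Longrightarrow> norm (Q p) \<le> K" "\<And>p. p \<in> ?B \<Longrightarrow> norm (P' p) \<le> K"
    by auto
  \<comment> \<open>Each of the two integrals in \<open>T\<close> has Lipschitz constant at most
    \<open>r * K\<close>, so \<open>1 / (4 * K)\<close> yields the contraction factor 1/2. The cap 1
    serves the later estimate of \<open>Z\<close>: an integral in v of a term bounded by
    \<open>K\<close> times the maximum is then itself bounded by \<open>K\<close> times the
    maximum.\<close>
  define r where "r = min R (min 1 (1 / (4 * K)))"
  have r: "r > 0" "r \<le> R" "r \<le> 1" "r * K \<le> 1 / 4"
  proof -
    have "r * K \<le> 1 / (4 * K) * K" using K(1) unfolding r_def by (intro mult_right_mono) auto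
    then show "r * K \<le> 1 / 4" using K(1) by simp
  qed (use R K(1) in \<open>auto simp: r_def\<close>)
  define I where "I = {c - r..c + r}"
  define J where "J = {d - r..d + r}"
  have cI: "c \<in> I" and dJ: "d \<in> J" using r by (auto simp: I_def J_def)
  have IJ: "I \<times> J = cbox (c - r, d - r) (c + r, d + r)" by (simp add: I_def J_def cbox_Pair_eq)
  have sub: "I \<times> J \<subseteq> ?B" using r by (auto simp: I_def J_def)
  have subD: "I \<times> J \<subseteq> D" using sub R(2) by blast
  have dist_I: "\<bar>u - c\<bar> \<le> r" if "u \<in> I" for u using that by (auto simp: I_def abs_le_iff)
  have dist_J: "\<bar>v - d\<bar> \<le> r" if "v \<in> J" for v using that by (auto simp: J_def abs_le_iff)
  note blc = blinfun.continuous_on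
  note contIJ = continuous_on_subset[OF cont(1) subD] continuous_on_subset[OF cont(2) subD]
    continuous_on_subset[OF cont(3) subD] continuous_on_subset[OF cont(4) subD]
  have comp: "continuous_on S (\<lambda>x. f (g x, h x))"
    if "continuous_on (I \<times> J) f" "continuous_on S g" "continuous_on S h"
      "\<And>x. x \<in> S \<Longrightarrow> g x \<in> I" "\<And>x. x \<in> S \<Longrightarrow> h x \<in> J"
    for f :: "real \<times> real \<Rightarrow> 'z::real_normed_vector" and S :: "'y::topological_space set" and g h
    using that by (intro continuous_on_compose2[OF that(1)] continuous_on_Pair) auto
  note comps = comp[OF contIJ(1)] comp[OF contIJ(2)] comp[OF contIJ(3)] comp[OF contIJ(4)]
  have apply_le: "norm (blinfun_apply F w) \<le> K * M" if "norm F \<le> K" "norm w \<le> M"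
    for F :: "'w \<Rightarrow>\<^sub>L 'w" and w M
    using norm_blinfun[of F w] mult_mono[OF that] K(1) by fastforce
  define T where "T = (\<lambda>f (u, v). w0 + seg_int d v (\<lambda>s. Q (c, s) (f (c, s)))
    + seg_int c u (\<lambda>t. P (t, v) (f (t, v))))"
  have contJ: "continuous_on J (\<lambda>s. Q (u, s) (f (u, s)))"
    and contI: "continuous_on I (\<lambda>t. P (t, v) (f (t, v)))"
    if "continuous_on (I \<times> J) f" "u \<in> I" "v \<in> J" for f u v
    using that by (auto intro!: blc comps comp[OF that(1)] continuous_intros)
  have "\<exists>W. continuous_on (I \<times> J) W \<and> (\<forall>p\<in>I \<times> J. T W p = W p)"
    unfolding IJ
  proof (rule contraction_on_cbox[where k = "1/2"]; (unfold IJ[symmetric])?)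
    fix f :: "real \<times> real \<Rightarrow> 'w" assume f: "continuous_on (I \<times> J) f"
    have "continuous_on (I \<times> J) (\<lambda>p. seg_int d (snd p) (\<lambda>s. Q (c, s) (f (c, s))))"
      using cI dJ by (intro continuous_on_seg_int[where a = "d - r" and b = "d + r"])
        (auto intro!: blc comps comp[OF f] continuous_intros simp: J_def[symmetric] case_prod_beta)
    moreover have "continuous_on (I \<times> J) (\<lambda>p. seg_int c (fst p) (\<lambda>t. P (t, snd p) (f (t, snd p))))"
      using cI dJ by (intro continuous_on_seg_int[where a = "c - r" and b = "c + r"])
        (auto intro!: blc comps comp[OF f] continuous_intros simp: I_def[symmetric] case_prod_beta)
    ultimately show "continuous_on (I \<times> J) (T f)"
      unfolding T_def case_prod_beta by (intro continuous_intros)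
  next
    fix f g :: "real \<times> real \<Rightarrow> 'w" and M p
    assume f: "continuous_on (I \<times> J) f" and g: "continuous_on (I \<times> J) g"
      and M: "\<And>q. q \<in> I \<times> J \<Longrightarrow> norm (f q - g q) \<le> M" and p: "p \<in> I \<times> J"
    obtain u v where uv: "p = (u, v)" "u \<in> I" "v \<in> J" using p by auto
    have fg: "continuous_on (I \<times> J) (\<lambda>q. f q - g q)" by (intro continuous_intros f g)
    have M0: "0 \<le> M" using M[OF p] norm_ge_zero order_trans by blast
    have "norm (seg_int d v (\<lambda>s. Q (c, s) (f (c, s))) - seg_int d v (\<lambda>s. Q (c, s) (g (c, s)))) \<le> \<bar>v - d\<bar> * (K * M)"
      using uv cI dJ sub
      by (intro norm_seg_int_diff_le[where a = "d - r" and b = "d + r"]; (fold J_def)?)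
        (auto simp: blinfun.diff_right[symmetric] intro!: contJ f g apply_le K M)
    also have "\<dots> \<le> r * (K * M)" using dist_J[OF uv(3)] K(1) M0 by (intro mult_right_mono) auto
    finally have 1: "norm (seg_int d v (\<lambda>s. Q (c, s) (f (c, s))) - seg_int d v (\<lambda>s. Q (c, s) (g (c, s)))) \<le> r * (K * M)" .
    have "norm (seg_int c u (\<lambda>t. P (t, v) (f (t, v))) - seg_int c u (\<lambda>t. P (t, v) (g (t, v)))) \<le> \<bar>u - c\<bar> * (K * M)"
      using uv cI dJ sub
      by (intro norm_seg_int_diff_le[where a = "c - r" and b = "c + r"]; (fold I_def)?)
        (auto simp: blinfun.diff_right[symmetric] intro!: contI f g apply_le K M)
    also have "\<dots> \<le> r * (K * M)" using dist_I[OF uv(2)] K(1) M0 by (intro mult_right_mono) auto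
    finally have 2: "norm (seg_int c u (\<lambda>t. P (t, v) (f (t, v))) - seg_int c u (\<lambda>t. P (t, v) (g (t, v)))) \<le> r * (K * M)" .
    have "T f p - T g p = (seg_int d v (\<lambda>s. Q (c, s) (f (c, s))) - seg_int d v (\<lambda>s. Q (c, s) (g (c, s))))
      + (seg_int c u (\<lambda>t. P (t, v) (f (t, v))) - seg_int c u (\<lambda>t. P (t, v) (g (t, v))))"
      by (simp add: T_def uv(1))
    also have "norm \<dots> \<le> r * (K * M) + r * (K * M)"
      by (rule order_trans[OF norm_triangle_ineq add_mono[OF 1 2]])
    also have "\<dots> = 2 * (r * K) * M" by simp
    also have "\<dots> \<le> 1 / 2 * M" using r(4) M0 by (intro mult_right_mono) auto
    finally show "norm (T f p - T g p) \<le> 1 / 2 * M" .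
  qed (use cI dJ in auto)
  then obtain W where contW: "continuous_on (I \<times> J) W"
    and fixW: "\<And>u v. u \<in> I \<Longrightarrow> v \<in> J \<Longrightarrow> T W (u, v) = W (u, v)"
    by auto
  have W_init: "W (c, d) = w0" using fixW[OF cI dJ] by (simp add: T_def)
  have Wu: "((\<lambda>u. W (u, v)) has_vector_derivative P (u, v) (W (u, v))) (at u within I)"
    if "u \<in> I" "v \<in> J" for u v
  proof (rule has_vector_derivative_transform[OF that(1) fixW[OF _ that(2), symmetric]])
    show "((\<lambda>u. T W (u, v)) has_vector_derivative P (u, v) (W (u, v))) (at u within I)"
      using seg_int_has_vector_derivative[of "c - r" "c + r" "\<lambda>t. P (t, v) (W (t, v))" c u]
        contI[OF contW cI that(2)] that cI
      by (auto simp: T_def I_def[symmetric] intro!: derivative_eq_intros)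
  qed
  \<comment> \<open>On the line \<open>u = c\<close> the second integral of \<open>T\<close> is
    empty, so there the v-equation holds by construction. This is what makes \<open>V\<close> and
    \<open>W\<close> agree on that line.\<close>
  have Wcv: "((\<lambda>v. W (c, v)) has_vector_derivative Q (c, v) (W (c, v))) (at v within J)"
    if "v \<in> J" for v
  proof (rule has_vector_derivative_transform[OF that fixW[OF cI, symmetric]])
    show "((\<lambda>v. T W (c, v)) has_vector_derivative Q (c, v) (W (c, v))) (at v within J)"
      using seg_int_has_vector_derivative[of "d - r" "d + r" "\<lambda>s. Q (c, s) (W (c, s))" d v]
        contJ[OF contW cI dJ] that dJ
      by (auto simp: T_def J_def[symmetric] intro!: derivative_eq_intros)
  qed
  \<comment> \<open>V satisfies the v-equation with W on the right-hand side. By compatibility Z = W - V satisfies a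
    homogeneous integro-differential equation in u alone, so no derivative of W in v is ever needed.\<close>
  define V where "V = (\<lambda>(u, v). W (u, d) + seg_int d v (\<lambda>s. Q (u, s) (W (u, s))))"
  have Vd: "V (u, d) = W (u, d)" for u by (simp add: V_def)
  have Vc: "V (c, v) = W (c, v)" if "v \<in> J" for v
    using seg_int_FTC[of "d - r" "d + r" "\<lambda>v. W (c, v)", OF Wcv[unfolded J_def]] that dJ
    by (simp add: V_def J_def[symmetric])
  have Vv: "((\<lambda>v. V (u, v)) has_vector_derivative Q (u, v) (W (u, v))) (at v within J)"
    if "u \<in> I" "v \<in> J" for u v
    using seg_int_has_vector_derivative[of "d - r" "d + r" "\<lambda>s. Q (u, s) (W (u, s))" d v]
      contJ[OF contW that(1) dJ] that dJ
    by (auto simp: V_def J_def[symmetric] intro!: derivative_eq_intros)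
  have contV: "continuous_on (I \<times> J) V"
  proof -
    have "continuous_on (I \<times> J) (\<lambda>p. seg_int d (snd p) (\<lambda>s. Q (fst p, s) (W (fst p, s))))"
      using cI dJ by (intro continuous_on_seg_int[where a = "d - r" and b = "d + r"])
        (auto intro!: blc comps comp[OF contW] continuous_intros simp: J_def[symmetric] case_prod_beta)
    moreover have "continuous_on (I \<times> J) (\<lambda>p. W (fst p, d))"
      using dJ by (intro comp[OF contW] continuous_intros) auto
    ultimately show ?thesis unfolding V_def case_prod_beta by (intro continuous_intros)
  qed
  have derP: "((\<lambda>v. P (u, v)) has_vector_derivative P' (u, v)) (at v within J)"
    and derQ: "((\<lambda>u. Q (u, v)) has_vector_derivative Q' (u, v)) (at u within I)"
    if "u \<in> I" "v \<in> J" for u v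
    using that subD by (auto intro!: has_vector_derivative_at_within P' Q')
  define Z where "Z = (\<lambda>p. W p - V p)"
  have contZ: "continuous_on (I \<times> J) Z" unfolding Z_def by (intro continuous_intros contW contV)
  have contP'Z: "continuous_on J (\<lambda>s. P' (u, s) (Z (u, s)))" if "u \<in> I" for u
    using that by (intro blc comps comp[OF contZ] continuous_intros) auto
  \<comment> \<open>Differentiation under the integral gives \<open>V_u\<close> as the value of
    \<open>P W\<close> at \<open>(u, d)\<close> plus the integral of \<open>Q P W + Q' W\<close>. On
    the other hand \<open>P V\<close> grows from \<open>d\<close> to \<open>v\<close> by the
    integral of \<open>P Q W + P' V\<close>. By compatibility the two integrands differ by
    \<open>P' (W - V)\<close>, so \<open>V_u\<close> is \<open>P V\<close> plus the integral of
    \<open>P' Z\<close>.\<close>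
  have Zu: "((\<lambda>u. Z (u, v)) has_vector_derivative
      P (u, v) (Z (u, v)) - seg_int d v (\<lambda>s. P' (u, s) (Z (u, s)))) (at u within I)"
    if uv: "u \<in> I" "v \<in> J" for u v
  proof -
    let ?f = "\<lambda>u s. Q (u, s) (P (u, s) (W (u, s))) + Q' (u, s) (W (u, s))"
    let ?g = "\<lambda>s. P (u, s) (Q (u, s) (W (u, s))) + P' (u, s) (V (u, s))"
    have "((\<lambda>u. seg_int d v (\<lambda>s. Q (u, s) (W (u, s)))) has_vector_derivative seg_int d v (?f u)) (at u within I)"
    proof (rule seg_int_leibniz[where a = "d - r" and b = "d + r"]; (fold J_def)?)
      show "continuous_on (I \<times> J) (\<lambda>(u, s). ?f u s)"
        unfolding case_prod_beta by (auto intro!: blc contIJ contW continuous_intros)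
    qed (use uv dJ contJ[OF contW] in \<open>auto intro!: blinfun.has_vector_derivative derQ Wu simp: I_def[symmetric]\<close>,
         auto simp: I_def)
    then have Vu: "((\<lambda>u. V (u, v)) has_vector_derivative P (u, d) (W (u, d)) + seg_int d v (?f u)) (at u within I)"
      using Wu[OF uv(1) dJ] by (auto simp: V_def intro!: derivative_eq_intros)
    have contf: "continuous_on J (?f u)" and contg: "continuous_on J ?g"
      using uv by (auto intro!: blc comps comp[OF contW] comp[OF contV] continuous_intros)
    have "seg_int d v ?g = P (u, v) (V (u, v)) - P (u, d) (V (u, d))"
      by (rule seg_int_FTC[where a = "d - r" and b = "d + r"]; (fold J_def)?)
        (use uv dJ in \<open>auto intro!: blinfun.has_vector_derivative derP Vv\<close>)
    moreover have "seg_int d v (?f u) - seg_int d v ?g = seg_int d v (\<lambda>s. P' (u, s) (Z (u, s)))"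
    proof -
      have "seg_int d v (?f u) - seg_int d v ?g = seg_int d v (\<lambda>s. ?f u s - ?g s)"
        by (rule seg_int_diff[symmetric, where a = "d - r" and b = "d + r"]; (fold J_def)?)
          (use contf contg uv dJ in auto)
      also have "\<dots> = seg_int d v (\<lambda>s. P' (u, s) (Z (u, s)))"
      proof (rule seg_int_cong[where a = "d - r" and b = "d + r"]; (fold J_def)?)
        fix s assume "s \<in> J"
        with uv subD compat[of "(u, s)" "W (u, s)"]
        show "?f u s - ?g s = P' (u, s) (Z (u, s))"
          by (auto simp: Z_def blinfun.diff_right algebra_simps)
      qed (use uv dJ in auto)
      finally show ?thesis .
    qed
    ultimately have "P (u, d) (W (u, d)) + seg_int d v (?f u)
        = P (u, v) (V (u, v)) + seg_int d v (\<lambda>s. P' (u, s) (Z (u, s)))"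
      by (simp add: Vd algebra_simps)
    with Vu Wu[OF uv] show ?thesis
      unfolding Z_def by (auto intro!: derivative_eq_intros simp: blinfun.diff_right)
  qed
  \<comment> \<open>Looking at a maximum of the norm replaces a Gronwall argument: \<open>Z\<close>
    vanishes on \<open>u = c\<close> and its u-derivative is at most \<open>2 * K\<close> times the
    maximum, so the maximum is at most \<open>2 * r * K\<close> times itself, hence at most half of
    itself.\<close>
  obtain p where p: "p \<in> I \<times> J" "\<And>q. q \<in> I \<times> J \<Longrightarrow> norm (Z q) \<le> norm (Z p)"
  proof -
    have "compact (I \<times> J)" by (simp add: IJ)
    moreover have "I \<times> J \<noteq> {}" using cI dJ by blast
    ultimately show ?thesis
      using continuous_attains_sup[OF _ _ continuous_on_norm[OF contZ]] that by blast
  qed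
  have "norm (Z p) \<le> 1 / 2 * norm (Z p)"
  proof -
    let ?M = "norm (Z p)"
    obtain u v where uv: "p = (u, v)" "u \<in> I" "v \<in> J" using p by auto
    have Z_le: "norm (Z (t, s)) \<le> ?M" if "t \<in> I" "s \<in> J" for t s
      using p(2) that by blast
    have "norm (P (t, v) (Z (t, v)) - seg_int d v (\<lambda>s. P' (t, s) (Z (t, s)))) \<le> 2 * K * ?M"
      if t: "t \<in> I" for t
    proof -
      have "norm (seg_int d v (\<lambda>s. P' (t, s) (Z (t, s)))) \<le> \<bar>v - d\<bar> * (K * ?M)"
        by (rule norm_seg_int_le[where a = "d - r" and b = "d + r"]; (fold J_def)?)
          (use t uv(2,3) dJ sub in \<open>auto intro!: contP'Z apply_le K Z_le\<close>)
      also have "\<dots> \<le> 1 * (K * ?M)"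
        using dist_J[OF uv(3)] r K(1) by (intro mult_right_mono) auto
      finally have "norm (seg_int d v (\<lambda>s. P' (t, s) (Z (t, s)))) \<le> K * ?M" by simp
      moreover have "norm (P (t, v) (Z (t, v))) \<le> K * ?M"
        using t uv(2,3) sub by (intro apply_le K Z_le) auto
      ultimately show ?thesis
        using norm_triangle_ineq4[of "P (t, v) (Z (t, v))" "seg_int d v (\<lambda>s. P' (t, s) (Z (t, s)))"]
        by linarith
    qed
    with Zu uv cI
    have "norm (Z (u, v) - Z (c, v)) \<le> 2 * K * ?M * \<bar>u - c\<bar>"
      unfolding I_def by (intro norm_diff_le_of_vector_derivative_bound) auto
    also have "\<dots> \<le> 2 * K * ?M * r"
      using dist_I[OF uv(2)] K(1) by (intro mult_left_mono) auto
    also have "\<dots> = 2 * (r * K) * ?M" by simp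
    also have "\<dots> \<le> 1 / 2 * ?M" using r(4) by (intro mult_right_mono) auto
    finally show ?thesis using Vc[OF uv(3)] by (simp add: Z_def uv(1))
  qed
  then have "W q = V q" if "q \<in> I \<times> J" for q
    using p(2)[OF that] by (simp add: Z_def)
  then have Wv: "((\<lambda>v. W (u, v)) has_vector_derivative Q (u, v) (W (u, v))) (at v within J)"
    if "u \<in> I" "v \<in> J" for u v
    using that by (intro has_vector_derivative_transform[OF that(2) _ Vv]) auto
  let ?S = "{c - r<..<c + r} \<times> {d - r<..<d + r}"
  have SIJ: "?S \<subseteq> I \<times> J" by (auto simp: I_def J_def)
  have inI: "at u within I = at u" if "u \<in> {c - r<..<c + r}" for u
    using that unfolding I_def by (intro at_within_interior) simp
  have inJ: "at v within J = at v" if "v \<in> {d - r<..<d + r}" for v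
    using that unfolding J_def by (intro at_within_interior) simp
  show ?thesis
  proof (rule that[of r W])
    show "?S \<subseteq> D" using SIJ subD by blast
    show "continuous_on ?S W" by (rule continuous_on_subset[OF contW SIJ])
    fix u v assume uv: "(u, v) \<in> ?S"
    then have "u \<in> I" "v \<in> J" by (auto simp: I_def J_def)
    with uv show "((\<lambda>u. W (u, v)) has_vector_derivative P (u, v) (W (u, v))) (at u)"
      "((\<lambda>v. W (u, v)) has_vector_derivative Q (u, v) (W (u, v))) (at v)"
      using Wu[of u v] Wv[of u v] inI[of u] inJ[of v] by auto
  qed (use r W_init in auto)
qed

section \<open>Smooth functions of two variables\<close>

lemma open_section:
  fixes S :: "('a::topological_space \<times> 'b::topological_space) set"
  assumes "open S"
  shows "open {t. (t, v) \<in> S}" "open {t. (u, t) \<in> S}"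
proof -
  have "open ((\<lambda>t. (t, v)) -` S)" "open ((\<lambda>t. (u, t)) -` S)"
    by (intro open_vimage[OF assms] continuous_intros)+
  then show "open {t. (t, v) \<in> S}" "open {t. (u, t) \<in> S}" by (simp_all add: vimage_def)
qed

lemma pu_eqI: "((\<lambda>t. f (t, v)) has_vector_derivative f') (at u) \<Longrightarrow> pu f (u, v) = f'"
  by (simp add: pu_def vector_derivative_at)

lemma pv_eqI: "((\<lambda>t. f (u, t)) has_vector_derivative f') (at v) \<Longrightarrow> pv f (u, v) = f'"
  by (simp add: pv_def vector_derivative_at)

lemma Ck_on_imp_continuous_on: "Ck_on k S f \<Longrightarrow> continuous_on S f"
  by (cases k) auto

lemma Ck_on_SucD:
  assumes "Ck_on (Suc k) S f" "(u, v) \<in> S"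
  shows "((\<lambda>t. f (t, v)) has_vector_derivative pu f (u, v)) (at u)"
    "((\<lambda>t. f (u, t)) has_vector_derivative pv f (u, v)) (at v)"
  using assms by (auto simp: pu_def pv_def vector_derivative_works[symmetric])

text \<open>A partial derivative at a point of \<open>S\<close> depends on the values along a short
  segment, which openness keeps inside \<open>S\<close>. The lemma matters because \<open>sE\<close>
  and \<open>sG\<close> are tied to their formulas on \<open>D\<close> only.\<close>

lemma Ck_on_cong:
  assumes "open S" "\<And>p. p \<in> S \<Longrightarrow> f p = g p" "Ck_on k S f"
  shows "Ck_on k S g"
  using assms(2,3)
proof (induction k arbitrary: f g)
  case 0
  then show ?case by (simp cong: continuous_on_cong)
next
  case (Suc k)
  have der: "((\<lambda>t. g (t, v)) has_vector_derivative pu f (u, v)) (at u)"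
    "((\<lambda>t. g (u, t)) has_vector_derivative pv f (u, v)) (at v)" if "(u, v) \<in> S" for u v
    by (rule has_vector_derivative_transform_within_open[OF Ck_on_SucD(1)[OF Suc.prems(2) that]
          open_section(1)[OF assms(1), of v]], use that Suc.prems(1) in simp_all,
        rule has_vector_derivative_transform_within_open[OF Ck_on_SucD(2)[OF Suc.prems(2) that]
          open_section(2)[OF assms(1), of u]], use that Suc.prems(1) in simp_all)
  have "Ck_on k S (pu g)" "Ck_on k S (pv g)"
    using Suc.prems(2) by (auto intro!: Suc.IH[of "pu f" "pu g"] Suc.IH[of "pv f" "pv g"]
        pu_eqI[symmetric] pv_eqI[symmetric] der)
  moreover have "continuous_on S g"
    using Suc.prems by (simp cong: continuous_on_cong)
  ultimately show ?case
    using differentiableI_vector[OF der(1)] differentiableI_vector[OF der(2)] by auto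
qed

text \<open>\<open>Ck_on\<close> refers to the particular functions \<open>pu f\<close> and
  \<open>pv f\<close>. This rule accepts explicit formulas for the derivatives, valid on
  \<open>S\<close> alone, which is the form in which the closure proofs below produce them.\<close>

lemma Ck_on_SucI:
  assumes "open S" "continuous_on S f"
    and "\<And>u v. (u, v) \<in> S \<Longrightarrow> ((\<lambda>t. f (t, v)) has_vector_derivative fu (u, v)) (at u)"
    and "\<And>u v. (u, v) \<in> S \<Longrightarrow> ((\<lambda>t. f (u, t)) has_vector_derivative fv (u, v)) (at v)"
    and "Ck_on k S fu" "Ck_on k S fv"
  shows "Ck_on (Suc k) S f"
proof -
  have "Ck_on k S (pu f)"
    by (rule Ck_on_cong[OF assms(1) _ assms(5)]) (auto intro!: pu_eqI[symmetric] assms(3))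
  moreover have "Ck_on k S (pv f)"
    by (rule Ck_on_cong[OF assms(1) _ assms(6)]) (auto intro!: pv_eqI[symmetric] assms(4))
  ultimately show ?thesis
    using assms(2) differentiableI_vector[OF assms(3)] differentiableI_vector[OF assms(4)] by auto
qed

lemma Ck_on_Suc_imp: "Ck_on (Suc k) S f \<Longrightarrow> Ck_on k S f"
proof (induction k arbitrary: f)
  case (Suc k)
  from Suc.prems have "Ck_on (Suc k) S (pu f)" "Ck_on (Suc k) S (pv f)"
    by (simp_all only: Ck_on.simps(2)[of "Suc k"])
  then have "Ck_on k S (pu f)" "Ck_on k S (pv f)" by (auto intro: Suc.IH simp del: Ck_on.simps)
  with Suc.prems show ?case unfolding Ck_on.simps(2) by blast
qed simp

lemma Ck_on_subset: "Ck_on k S f \<Longrightarrow> T \<subseteq> S \<Longrightarrow> Ck_on k T f"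
proof (induction k arbitrary: f)
  case (Suc k)
  then show ?case by (auto intro: continuous_on_subset)
qed (auto intro: continuous_on_subset)

lemma Ck_on_const:
  assumes "open S"
  shows "Ck_on k S (\<lambda>p. c)"
proof (induction k arbitrary: c)
  case (Suc k)
  show ?case
    by (rule Ck_on_SucI[where fu = "\<lambda>p. 0" and fv = "\<lambda>p. 0"])
      (simp_all add: assms Suc.IH del: Ck_on.simps)
qed simp

lemma Ck_on_add:
  assumes "open S" "Ck_on k S f" "Ck_on k S g"
  shows "Ck_on k S (\<lambda>p. f p + g p)"
  using assms(2,3)
proof (induction k arbitrary: f g)
  case (Suc k)
  note der = Ck_on_SucD[OF Suc.prems(1)] Ck_on_SucD[OF Suc.prems(2)]
  show ?case
    using Suc.prems
    by (intro Ck_on_SucI[where fu = "\<lambda>p. pu f p + pu g p" and fv = "\<lambda>p. pv f p + pv g p"]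
        assms(1) continuous_on_add has_vector_derivative_add der Suc.IH) auto
qed (simp add: continuous_on_add)

lemma Ck_on_sum:
  assumes "open S" "\<And>i. i \<in> I \<Longrightarrow> Ck_on k S (f i)"
  shows "Ck_on k S (\<lambda>p. \<Sum>i\<in>I. f i p)"
  using assms(2)
  by (induction I rule: infinite_finite_induct) (simp_all add: Ck_on_add Ck_on_const assms(1))

text \<open>The product rule leaves an undifferentiated factor in each term, so the induction step
  needs \<open>f\<close> and \<open>g\<close> themselves at level \<open>k\<close>, besides their
  partial derivatives.\<close>

lemma Ck_on_scaleR:
  fixes f :: "real \<times> real \<Rightarrow> real"
  assumes "open S" "Ck_on k S f" "Ck_on k S g"
  shows "Ck_on k S (\<lambda>p. f p *\<^sub>R g p)"
  using assms(2,3)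
proof (induction k arbitrary: f g)
  case (Suc k)
  note der = Ck_on_SucD[OF Suc.prems(1)] Ck_on_SucD[OF Suc.prems(2)]
  have "Ck_on k S f" "Ck_on k S g" by (rule Ck_on_Suc_imp, fact Suc.prems)+
  then show ?case
    using Suc.prems
    by (intro Ck_on_SucI[where fu = "\<lambda>p. f p *\<^sub>R pu g p + pu f p *\<^sub>R g p"
          and fv = "\<lambda>p. f p *\<^sub>R pv g p + pv f p *\<^sub>R g p"]
        assms(1) continuous_on_scaleR
        bounded_bilinear.has_vector_derivative[OF bounded_bilinear_scaleR] der Suc.IH Ck_on_add) auto
qed (simp add: continuous_on_scaleR)

lemma Ck_on_mult:
  fixes f g :: "real \<times> real \<Rightarrow> real"
  assumes "open S" "Ck_on k S f" "Ck_on k S g"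
  shows "Ck_on k S (\<lambda>p. f p * g p)"
  using Ck_on_scaleR[OF assms] by simp

lemma Ck_on_uminus:
  fixes f :: "real \<times> real \<Rightarrow> real"
  assumes "open S" "Ck_on k S f"
  shows "Ck_on k S (\<lambda>p. - f p)"
  using Ck_on_mult[OF assms(1) Ck_on_const[OF assms(1), of _ "-1"] assms(2)] by simp

text \<open>The derivative is written as a product of \<open>pu f\<close> or \<open>pv f\<close>
  with two copies of the inverse. The inverse is of class \<open>k\<close> by the induction
  hypothesis, so closure under products finishes the step.\<close>

lemma Ck_on_inverse:
  fixes f :: "real \<times> real \<Rightarrow> real"
  assumes "open S" "Ck_on k S f" and nz: "\<And>p. p \<in> S \<Longrightarrow> f p \<noteq> 0"
  shows "Ck_on k S (\<lambda>p. inverse (f p))"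
  using assms(2)
proof (induction k)
  case (Suc k)
  have inv: "Ck_on k S (\<lambda>p. inverse (f p))" by (rule Suc.IH[OF Ck_on_Suc_imp[OF Suc.prems]])
  have der: "((\<lambda>t. inverse (f (t, v))) has_vector_derivative
       - (inverse (f (u, v)) * (pu f (u, v) * inverse (f (u, v))))) (at u)"
    "((\<lambda>t. inverse (f (u, t))) has_vector_derivative
       - (inverse (f (u, v)) * (pv f (u, v) * inverse (f (u, v))))) (at v)" if "(u, v) \<in> S" for u v
    using Ck_on_SucD[OF Suc.prems that] nz[OF that]
    by (auto simp: has_real_derivative_iff_has_vector_derivative[symmetric] mult.assoc
        intro!: DERIV_inverse'[THEN DERIV_cong])
  show ?case
    using Suc.prems nz
    by (intro Ck_on_SucI[where fu = "\<lambda>p. - (inverse (f p) * (pu f p * inverse (f p)))"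
          and fv = "\<lambda>p. - (inverse (f p) * (pv f p * inverse (f p)))"]
        assms(1) continuous_on_inverse der Ck_on_uminus Ck_on_mult inv) auto
qed (simp add: continuous_on_inverse nz)

lemma smooth_on_imp_Ck_on: "smooth_on S f \<Longrightarrow> Ck_on k S f"
  by (simp add: smooth_on_def)

lemma smooth_on_imp_continuous_on: "smooth_on S f \<Longrightarrow> continuous_on S f"
  by (rule Ck_on_imp_continuous_on[OF smooth_on_imp_Ck_on])

lemma smooth_on_pu: "smooth_on S f \<Longrightarrow> smooth_on S (pu f)"
  and smooth_on_pv: "smooth_on S f \<Longrightarrow> smooth_on S (pv f)"
proof -
  assume "smooth_on S f"
  then have "Ck_on (Suc k) S f" for k by (rule smooth_on_imp_Ck_on)
  then show "smooth_on S (pu f)" "smooth_on S (pv f)" by (simp_all add: smooth_on_def)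
qed

lemmas smooth_on_has_pu = Ck_on_SucD(1)[OF smooth_on_imp_Ck_on]
  and smooth_on_has_pv = Ck_on_SucD(2)[OF smooth_on_imp_Ck_on]

lemma smooth_on_subset: "smooth_on S f \<Longrightarrow> T \<subseteq> S \<Longrightarrow> smooth_on T f"
  unfolding smooth_on_def by (blast intro: Ck_on_subset)

lemma smooth_on_cong: "open S \<Longrightarrow> (\<And>p. p \<in> S \<Longrightarrow> f p = g p) \<Longrightarrow> smooth_on S f \<Longrightarrow> smooth_on S g"
  unfolding smooth_on_def using Ck_on_cong[of S f g] by simp

lemma smooth_on_const: "open S \<Longrightarrow> smooth_on S (\<lambda>p. c)"
  by (simp add: smooth_on_def Ck_on_const)

lemma smooth_on_add: "open S \<Longrightarrow> smooth_on S f \<Longrightarrow> smooth_on S g \<Longrightarrow> smooth_on S (\<lambda>p. f p + g p)"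
  by (simp add: smooth_on_def Ck_on_add)

lemma smooth_on_uminus:
  fixes f :: "real \<times> real \<Rightarrow> real"
  shows "open S \<Longrightarrow> smooth_on S f \<Longrightarrow> smooth_on S (\<lambda>p. - f p)"
  by (simp add: smooth_on_def Ck_on_uminus)

lemma smooth_on_mult:
  fixes f g :: "real \<times> real \<Rightarrow> real"
  shows "open S \<Longrightarrow> smooth_on S f \<Longrightarrow> smooth_on S g \<Longrightarrow> smooth_on S (\<lambda>p. f p * g p)"
  by (simp add: smooth_on_def Ck_on_mult)

lemma smooth_on_diff:
  fixes f g :: "real \<times> real \<Rightarrow> real"
  shows "open S \<Longrightarrow> smooth_on S f \<Longrightarrow> smooth_on S g \<Longrightarrow> smooth_on S (\<lambda>p. f p - g p)"
  unfolding diff_conv_add_uminus by (intro smooth_on_add smooth_on_uminus)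

lemma smooth_on_divide:
  fixes f g :: "real \<times> real \<Rightarrow> real"
  assumes "open S" "smooth_on S f" "smooth_on S g" "\<And>p. p \<in> S \<Longrightarrow> g p \<noteq> 0"
  shows "smooth_on S (\<lambda>p. f p / g p)"
  unfolding smooth_on_def divide_inverse
  by (intro allI Ck_on_mult Ck_on_inverse assms smooth_on_imp_Ck_on)

text \<open>Bootstrapping: the partial derivatives are combinations of the \<open>F j\<close> with
  smooth coefficients, so if every \<open>F j\<close> is of class \<open>k\<close>, every one is of
  class \<open>k + 1\<close>. Since all components enter each equation, the induction generalizes
  over \<open>i\<close>.\<close>

lemma smooth_on_of_linear_system:
  fixes F :: "'n::finite \<Rightarrow> real \<times> real \<Rightarrow> 'v::real_normed_vector"
  assumes "open S" "\<And>i. continuous_on S (F i)"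
    and A: "\<And>i j. smooth_on S (A i j)" and B: "\<And>i j. smooth_on S (B i j)"
    and "\<And>i u v. (u, v) \<in> S \<Longrightarrow>
      ((\<lambda>t. F i (t, v)) has_vector_derivative (\<Sum>j\<in>UNIV. A i j (u, v) *\<^sub>R F j (u, v))) (at u)"
    and "\<And>i u v. (u, v) \<in> S \<Longrightarrow>
      ((\<lambda>t. F i (u, t)) has_vector_derivative (\<Sum>j\<in>UNIV. B i j (u, v) *\<^sub>R F j (u, v))) (at v)"
  shows "smooth_on S (F i)"
  unfolding smooth_on_def
proof
  fix k show "Ck_on k S (F i)"
  proof (induction k arbitrary: i)
    case (Suc k)
    show ?case
      by (rule Ck_on_SucI[where fu = "\<lambda>p. \<Sum>j\<in>UNIV. A i j p *\<^sub>R F j p"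
            and fv = "\<lambda>p. \<Sum>j\<in>UNIV. B i j p *\<^sub>R F j p"])
        (auto intro!: assms(1,2,5,6) Ck_on_sum Ck_on_scaleR smooth_on_imp_Ck_on[OF A]
          smooth_on_imp_Ck_on[OF B] Suc.IH)
  qed (simp add: assms(2))
qed

section \<open>From operators to coefficient matrices\<close>

lemma bounded_linear_axis_nth:
  "bounded_linear (\<lambda>w :: 'b::real_normed_vector ^ 'n::finite. axis i (w $ j) :: 'b ^ 'n)"
proof (rule bounded_linear_intro[where K = 1])
  fix w :: "'b ^ 'n"
  have "norm (axis i (w $ j) :: 'b ^ 'n) = norm (w $ j)"
    unfolding norm_vec_def L2_set_def axis_def
    by (simp add: if_distrib[of norm] if_distrib[of "\<lambda>x. x\<^sup>2"] cong: if_cong)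
  then show "norm (axis i (w $ j) :: 'b ^ 'n) \<le> norm w * 1"
    using Finite_Cartesian_Product.norm_nth_le[of w j] by simp
qed (simp_all add: vec_eq_iff axis_def)

text \<open>The unknowns are vectors in \<open>'b\<close> while the coefficients are real, so a
  matrix acts on \<open>'b ^ 'n\<close> through block matrix units: \<open>E i j\<close> moves
  component \<open>j\<close> to slot \<open>i\<close>. Matrix products become compositions, and
  operator compatibility is checked one component at a time.\<close>

lemma linear_pfaffian_system_local:
  fixes A B :: "'n::finite \<Rightarrow> 'n \<Rightarrow> real \<times> real \<Rightarrow> real" and w0 :: "'n \<Rightarrow> 'b::banach"
  assumes D: "open D" "(c, d) \<in> D"
    and A: "\<And>i j. smooth_on D (A i j)" and B: "\<And>i j. smooth_on D (B i j)"
    and compat: "\<And>i k p. p \<in> D \<Longrightarrow> pv (A i k) p + (\<Sum>j\<in>UNIV. A i j p * B j k p)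
        = pu (B i k) p + (\<Sum>j\<in>UNIV. B i j p * A j k p)"
  obtains r F where "r > 0" "{c - r<..<c + r} \<times> {d - r<..<d + r} \<subseteq> D" "\<And>i. F i (c, d) = w0 i"
    "\<And>i. smooth_on ({c - r<..<c + r} \<times> {d - r<..<d + r}) (F i)"
    "\<And>i u v. (u, v) \<in> {c - r<..<c + r} \<times> {d - r<..<d + r} \<Longrightarrow>
       ((\<lambda>t. F i (t, v)) has_vector_derivative (\<Sum>j\<in>UNIV. A i j (u, v) *\<^sub>R F j (u, v))) (at u)"
    "\<And>i u v. (u, v) \<in> {c - r<..<c + r} \<times> {d - r<..<d + r} \<Longrightarrow>
       ((\<lambda>t. F i (u, t)) has_vector_derivative (\<Sum>j\<in>UNIV. B i j (u, v) *\<^sub>R F j (u, v))) (at v)"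
proof -
  define E :: "'n \<Rightarrow> 'n \<Rightarrow> ('b ^ 'n) \<Rightarrow>\<^sub>L ('b ^ 'n)" where "E i j = Blinfun (\<lambda>w. axis i (w $ j))" for i j
  define op where "op M p = (\<Sum>i\<in>UNIV. \<Sum>j\<in>UNIV. M i j p *\<^sub>R E i j)"
    for M :: "'n \<Rightarrow> 'n \<Rightarrow> real \<times> real \<Rightarrow> real" and p
  have op_nth: "blinfun_apply (op M p) w $ i = (\<Sum>j\<in>UNIV. M i j p *\<^sub>R w $ j)" for M p w i
  proof -
    have "blinfun_apply (op M p) w $ i = (\<Sum>i'\<in>UNIV. \<Sum>j\<in>UNIV. M i' j p *\<^sub>R axis i' (w $ j) $ i)"
      by (simp add: op_def E_def blinfun.sum_left blinfun.scaleR_left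
          bounded_linear_Blinfun_apply[OF bounded_linear_axis_nth])
    also have "\<dots> = (\<Sum>i'\<in>UNIV. \<Sum>j\<in>UNIV. if i = i' then M i j p *\<^sub>R w $ j else 0)"
      by (intro sum.cong) (auto simp: axis_def)
    also have "\<dots> = (\<Sum>j\<in>UNIV. M i j p *\<^sub>R w $ j)"
      by (subst sum.swap) simp
    finally show ?thesis .
  qed
  have op_cont: "continuous_on D (op M)" if "\<And>i j. continuous_on D (M i j)" for M
    unfolding op_def using that by (intro continuous_intros) auto
  have pvA: "((\<lambda>v. op A (u, v)) has_vector_derivative op (\<lambda>i j. pv (A i j)) (u, v)) (at v)"
    and puB: "((\<lambda>u. op B (u, v)) has_vector_derivative op (\<lambda>i j. pu (B i j)) (u, v)) (at u)"
    if "(u, v) \<in> D" for u v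
    unfolding op_def
    by (intro has_vector_derivative_sum bounded_linear.has_vector_derivative[OF bounded_linear_scaleR_left]
        smooth_on_has_pv[OF A that] smooth_on_has_pu[OF B that])+
  have prod_nth: "blinfun_apply (op M p) (blinfun_apply (op N p) w) $ i
      = (\<Sum>k\<in>UNIV. (\<Sum>j\<in>UNIV. M i j p * N j k p) *\<^sub>R w $ k)" for M N p w i
    by (simp add: op_nth scaleR_sum_right scaleR_sum_left) (rule sum.swap)
  have op_compat: "blinfun_apply (op (\<lambda>i j. pv (A i j)) p) w + blinfun_apply (op A p) (blinfun_apply (op B p) w)
      = blinfun_apply (op (\<lambda>i j. pu (B i j)) p) w + blinfun_apply (op B p) (blinfun_apply (op A p) w)"
    if "p \<in> D" for p w
  proof -
    have nth: "(blinfun_apply (op M p) w + blinfun_apply (op N p) (blinfun_apply (op N' p) w)) $ i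
        = (\<Sum>k\<in>UNIV. (M i k p + (\<Sum>j\<in>UNIV. N i j p * N' j k p)) *\<^sub>R w $ k)" for M N N' i
      by (simp only: vector_add_component prod_nth) (simp only: op_nth scaleR_left_distrib sum.distrib)
    show ?thesis
      unfolding vec_eq_iff nth compat[OF that] by (rule allI, rule refl)
  qed
  let ?S = "\<lambda>r. {c - r<..<c + r} \<times> {d - r<..<d + r}"
  obtain r W where "r > 0" and S: "?S r \<subseteq> D" and init: "W (c, d) = (\<chi> i. w0 i)"
    and contW: "continuous_on (?S r) W"
    and Wu: "\<And>u v. (u, v) \<in> ?S r \<Longrightarrow>
       ((\<lambda>u. W (u, v)) has_vector_derivative op A (u, v) (W (u, v))) (at u)"
    and Wv: "\<And>u v. (u, v) \<in> ?S r \<Longrightarrow>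
       ((\<lambda>v. W (u, v)) has_vector_derivative op B (u, v) (W (u, v))) (at v)"
    by (rule linear_pfaffian_local[where ?w0.0 = "\<chi> i. w0 i", OF D op_cont[OF smooth_on_imp_continuous_on[OF A]]
          op_cont[OF smooth_on_imp_continuous_on[OF B]]
          op_cont[OF smooth_on_imp_continuous_on[OF smooth_on_pv[OF A]]]
          op_cont[OF smooth_on_imp_continuous_on[OF smooth_on_pu[OF B]]] pvA puB op_compat];
        (assumption | (rule that; assumption)))
  define F where "F i p = W p $ i" for i p
  have Fu: "((\<lambda>t. F i (t, v)) has_vector_derivative (\<Sum>j\<in>UNIV. A i j (u, v) *\<^sub>R F j (u, v))) (at u)"
    and Fv: "((\<lambda>t. F i (u, t)) has_vector_derivative (\<Sum>j\<in>UNIV. B i j (u, v) *\<^sub>R F j (u, v))) (at v)"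
    if "(u, v) \<in> ?S r" for i u v
    using bounded_linear.has_vector_derivative[OF bounded_linear_vec_nth Wu[OF that], of i]
      bounded_linear.has_vector_derivative[OF bounded_linear_vec_nth Wv[OF that], of i]
    by (simp_all only: F_def op_nth)
  have openS: "open (?S r)" by (intro open_Times open_greaterThanLessThan)
  have "continuous_on (?S r) (F i)" for i
    unfolding F_def by (intro continuous_intros contW)
  then have smooth: "smooth_on (?S r) (F i)" for i
    by (rule smooth_on_of_linear_system[OF openS _ smooth_on_subset[OF A S] smooth_on_subset[OF B S] Fu Fv])
  have "F i (c, d) = w0 i" for i by (simp add: F_def init)
  from that[OF \<open>r > 0\<close> S this smooth Fu Fv] show ?thesis .
qed

lemma constant_on_rectangle:
  fixes f :: "real \<times> real \<Rightarrow> 'v::real_normed_vector"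
  assumes fu: "\<And>u v. (u, v) \<in> {a<..<b} \<times> {a'<..<b'} \<Longrightarrow> ((\<lambda>t. f (t, v)) has_vector_derivative 0) (at u)"
    and fv: "\<And>u v. (u, v) \<in> {a<..<b} \<times> {a'<..<b'} \<Longrightarrow> ((\<lambda>t. f (u, t)) has_vector_derivative 0) (at v)"
    and "p \<in> {a<..<b} \<times> {a'<..<b'}" "q \<in> {a<..<b} \<times> {a'<..<b'}"
  shows "f p = f q"
proof -
  obtain u v u' v' where p: "p = (u, v)" "u \<in> {a<..<b}" "v \<in> {a'<..<b'}"
    and q: "q = (u', v')" "u' \<in> {a<..<b}" "v' \<in> {a'<..<b'}"
    using assms(3,4) by (cases p, cases q) blast
  have "((\<lambda>t. f (t, v)) has_vector_derivative 0) (at t within {a<..<b})" if "t \<in> {a<..<b}" for t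
    by (rule has_vector_derivative_at_within, rule fu) (use that p in auto)
  then obtain k where k: "\<And>t. t \<in> {a<..<b} \<Longrightarrow> f (t, v) = k"
    by (rule has_vector_derivative_zero_constant[rotated]) auto
  have "((\<lambda>t. f (u', t)) has_vector_derivative 0) (at t within {a'<..<b'})" if "t \<in> {a'<..<b'}" for t
    by (rule has_vector_derivative_at_within, rule fv) (use that q in auto)
  then obtain k' where k': "\<And>t. t \<in> {a'<..<b'} \<Longrightarrow> f (u', t) = k'"
    by (rule has_vector_derivative_zero_constant[rotated]) auto
  have "f (u, v) = f (u', v)" using k[OF p(2)] k[OF q(2)] by simp
  also have "\<dots> = f (u', v')" using k'[OF p(3)] k'[OF q(3)] by simp
  finally show ?thesis by (simp add: p(1) q(1))
qed

section \<open>Skew-symmetric frame equations\<close>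

text \<open>The numbers \<open>k1\<close> to \<open>k6\<close> are the entries above the diagonal of
  a general skew 4 by 4 matrix, in the order xy, xb, xl, yb, yl, bl. The condition concerns one real
  variable at one parameter value, so it serves both coordinate directions.\<close>

definition frenet_ode ::
    "(real \<Rightarrow> 'v::real_inner) \<Rightarrow> (real \<Rightarrow> 'v) \<Rightarrow> (real \<Rightarrow> 'v) \<Rightarrow> (real \<Rightarrow> 'v) \<Rightarrow> real \<Rightarrow>
     real \<Rightarrow> real \<Rightarrow> real \<Rightarrow> real \<Rightarrow> real \<Rightarrow> real \<Rightarrow> bool" where
  "frenet_ode x y b l t k1 k2 k3 k4 k5 k6 \<longleftrightarrow>
     (x has_vector_derivative k1 *\<^sub>R y t + k2 *\<^sub>R b t + k3 *\<^sub>R l t) (at t) \<and>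
     (y has_vector_derivative - k1 *\<^sub>R x t + k4 *\<^sub>R b t + k5 *\<^sub>R l t) (at t) \<and>
     (b has_vector_derivative - k2 *\<^sub>R x t - k4 *\<^sub>R y t + k6 *\<^sub>R l t) (at t) \<and>
     (l has_vector_derivative - k3 *\<^sub>R x t - k5 *\<^sub>R y t - k6 *\<^sub>R b t) (at t)"

lemma frenet_ode_diff:
  assumes "frenet_ode x y b l t k1 k2 k3 k4 k5 k6" "frenet_ode x' y' b' l' t k1 k2 k3 k4 k5 k6"
  shows "frenet_ode (\<lambda>t. x t - x' t) (\<lambda>t. y t - y' t) (\<lambda>t. b t - b' t) (\<lambda>t. l t - l' t) t k1 k2 k3 k4 k5 k6"
  using assms unfolding frenet_ode_def
  by (auto elim!: has_vector_derivative_eq_rhs[OF has_vector_derivative_diff] simp: algebra_simps)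

text \<open>Both quantities below are constant along solutions because the coefficient matrix is skew. This
  gives uniqueness and orthonormality without a Gronwall estimate.\<close>

definition frame_energy :: "'v::real_inner \<Rightarrow> 'v \<Rightarrow> 'v \<Rightarrow> 'v \<Rightarrow> real" where
  "frame_energy x y b l = x \<bullet> x + y \<bullet> y + b \<bullet> b + l \<bullet> l"

definition gram_defect :: "'v::real_inner \<Rightarrow> 'v \<Rightarrow> 'v \<Rightarrow> 'v \<Rightarrow> real" where
  "gram_defect x y b l = (x \<bullet> x - 1)\<^sup>2 + (y \<bullet> y - 1)\<^sup>2 + (b \<bullet> b - 1)\<^sup>2 + (l \<bullet> l - 1)\<^sup>2
     + 2 * ((x \<bullet> y)\<^sup>2 + (x \<bullet> b)\<^sup>2 + (x \<bullet> l)\<^sup>2 + (y \<bullet> b)\<^sup>2 + (y \<bullet> l)\<^sup>2 + (b \<bullet> l)\<^sup>2)"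

lemma gram_defect_eq_0_iff: "gram_defect x y b l = 0 \<longleftrightarrow> orthonormal4 x y b l"
  unfolding gram_defect_def orthonormal4_def
  by (auto simp: add_nonneg_eq_0_iff)

lemma frame_energy_eq_0_iff: "frame_energy x y b l = 0 \<longleftrightarrow> x = 0 \<and> y = 0 \<and> b = 0 \<and> l = 0"
  unfolding frame_energy_def by (simp add: add_nonneg_eq_0_iff conj_ac)

lemma frenet_ode_frame_energy:
  assumes "frenet_ode x y b l t k1 k2 k3 k4 k5 k6"
  shows "((\<lambda>t. frame_energy (x t) (y t) (b t) (l t)) has_vector_derivative 0) (at t)"
proof -
  note d = assms[unfolded frenet_ode_def]
  note der = d[THEN conjunct1] d[THEN conjunct2, THEN conjunct1]
    d[THEN conjunct2, THEN conjunct2, THEN conjunct1] d[THEN conjunct2, THEN conjunct2, THEN conjunct2]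
  note inner = bounded_bilinear.has_vector_derivative[OF bounded_bilinear_inner]
  show ?thesis
    unfolding frame_energy_def
    apply (rule has_vector_derivative_eq_rhs)
     apply (rule has_vector_derivative_add inner der)+
    by (simp add: inner_simps inner_commute algebra_simps)
qed

text \<open>\<open>gram_defect\<close> is the squared Frobenius norm of \<open>G - I\<close> for the
  Gram matrix \<open>G\<close>; the factor 2 accounts for the entries below the diagonal. With skew
  coefficient matrix \<open>K\<close>, the derivative of \<open>G\<close> is
  \<open>K G - G K\<close>, which is also the commutator of \<open>K\<close> with
  \<open>G - I\<close>. The trace of \<open>G - I\<close> times this commutator is 0.\<close>

lemma frenet_ode_gram_defect:
  assumes "frenet_ode x y b l t k1 k2 k3 k4 k5 k6"
  shows "((\<lambda>t. gram_defect (x t) (y t) (b t) (l t)) has_vector_derivative 0) (at t)"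
proof -
  note d = assms[unfolded frenet_ode_def]
  note der = d[THEN conjunct1] d[THEN conjunct2, THEN conjunct1]
    d[THEN conjunct2, THEN conjunct2, THEN conjunct1] d[THEN conjunct2, THEN conjunct2, THEN conjunct2]
  note inner = bounded_bilinear.has_vector_derivative[OF bounded_bilinear_inner]
  show ?thesis
    unfolding gram_defect_def power2_eq_square
    apply (rule has_vector_derivative_eq_rhs)
     apply (rule has_vector_derivative_add has_vector_derivative_diff
        has_vector_derivative_mult has_vector_derivative_const inner der)+
    by (simp add: inner_simps inner_commute algebra_simps)
qed

text \<open>The position vector is treated as a fifth unknown: its derivatives are linear in the frame, so
  existence of the surface and of its frame is a single linear system.\<close>

datatype slot = Pos | FX | FY | FB | FL

lemma UNIV_slot: "UNIV = {Pos, FX, FY, FB, FL}"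
  using slot.exhaust by auto

instance slot :: finite
  by standard (simp add: UNIV_slot)

text \<open>The first slot names the unknown that is differentiated. The four frame slots carry the
  skew matrix of \<open>frenet_ode\<close>, the row \<open>Pos\<close> holds the components of a
  derivative of the position, and the column \<open>Pos\<close> is zero because the position enters
  no right-hand side.\<close>

fun frame_coeff ::
    "('p \<Rightarrow> real) \<Rightarrow> ('p \<Rightarrow> real) \<Rightarrow> ('p \<Rightarrow> real) \<Rightarrow> ('p \<Rightarrow> real) \<Rightarrow> ('p \<Rightarrow> real) \<Rightarrow> ('p \<Rightarrow> real) \<Rightarrow>
     ('p \<Rightarrow> real) \<Rightarrow> ('p \<Rightarrow> real) \<Rightarrow> slot \<Rightarrow> slot \<Rightarrow> 'p \<Rightarrow> real" where
  "frame_coeff e1 e2 k1 k2 k3 k4 k5 k6 Pos FX = e1"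
| "frame_coeff e1 e2 k1 k2 k3 k4 k5 k6 Pos FY = e2"
| "frame_coeff e1 e2 k1 k2 k3 k4 k5 k6 FX FY = k1"
| "frame_coeff e1 e2 k1 k2 k3 k4 k5 k6 FX FB = k2"
| "frame_coeff e1 e2 k1 k2 k3 k4 k5 k6 FX FL = k3"
| "frame_coeff e1 e2 k1 k2 k3 k4 k5 k6 FY FX = (\<lambda>p. - k1 p)"
| "frame_coeff e1 e2 k1 k2 k3 k4 k5 k6 FY FB = k4"
| "frame_coeff e1 e2 k1 k2 k3 k4 k5 k6 FY FL = k5"
| "frame_coeff e1 e2 k1 k2 k3 k4 k5 k6 FB FX = (\<lambda>p. - k2 p)"
| "frame_coeff e1 e2 k1 k2 k3 k4 k5 k6 FB FY = (\<lambda>p. - k4 p)"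
| "frame_coeff e1 e2 k1 k2 k3 k4 k5 k6 FB FL = k6"
| "frame_coeff e1 e2 k1 k2 k3 k4 k5 k6 FL FX = (\<lambda>p. - k3 p)"
| "frame_coeff e1 e2 k1 k2 k3 k4 k5 k6 FL FY = (\<lambda>p. - k5 p)"
| "frame_coeff e1 e2 k1 k2 k3 k4 k5 k6 FL FB = (\<lambda>p. - k6 p)"
| "frame_coeff e1 e2 k1 k2 k3 k4 k5 k6 _ _ = (\<lambda>p. 0)"

lemma smooth_on_frame_coeff:
  assumes "open S" "smooth_on S e1" "smooth_on S e2" "smooth_on S k1" "smooth_on S k2"
    "smooth_on S k3" "smooth_on S k4" "smooth_on S k5" "smooth_on S k6"
  shows "smooth_on S (frame_coeff e1 e2 k1 k2 k3 k4 k5 k6 i j)"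
  by (cases i; cases j) (simp_all add: assms smooth_on_uminus smooth_on_const)

section \<open>Partial derivatives and the entries of the compatibility condition\<close>

lemma
  fixes f :: "real \<times> real \<Rightarrow> real"
  assumes "smooth_on S f" "p \<in> S"
  shows pu_uminus: "pu (\<lambda>p. - f p) p = - pu f p"
    and pv_uminus: "pv (\<lambda>p. - f p) p = - pv f p"
proof -
  obtain u v where p: "p = (u, v)" by (cases p)
  show "pu (\<lambda>p. - f p) p = - pu f p" "pv (\<lambda>p. - f p) p = - pv f p"
    unfolding p by (intro pu_eqI pv_eqI has_vector_derivative_minus
        smooth_on_has_pu[OF assms[unfolded p]] smooth_on_has_pv[OF assms[unfolded p]])+
qed

lemma
  fixes f g :: "real \<times> real \<Rightarrow> real"
  assumes "smooth_on S f" "smooth_on S g" "p \<in> S"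
  shows pu_mult: "pu (\<lambda>p. f p * g p) p = f p * pu g p + pu f p * g p"
    and pv_mult: "pv (\<lambda>p. f p * g p) p = f p * pv g p + pv f p * g p"
proof -
  obtain u v where p: "p = (u, v)" by (cases p)
  show "pu (\<lambda>p. f p * g p) p = f p * pu g p + pu f p * g p"
    "pv (\<lambda>p. f p * g p) p = f p * pv g p + pv f p * g p"
    unfolding p by (intro pu_eqI pv_eqI has_vector_derivative_mult
        smooth_on_has_pu[OF assms(1) assms(3)[unfolded p]] smooth_on_has_pv[OF assms(1) assms(3)[unfolded p]]
        smooth_on_has_pu[OF assms(2) assms(3)[unfolded p]] smooth_on_has_pv[OF assms(2) assms(3)[unfolded p]])+
qed

lemma pu_const [simp]: "pu (\<lambda>p. c) p = 0"
  and pv_const [simp]: "pv (\<lambda>p. c) p = 0"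
  by (simp_all add: pu_def pv_def split: prod.splits)

text \<open>Ten of the 25 entries carry information. The column \<open>Pos\<close> is trivial and
  the rest of the row \<open>Pos\<close> gives the first four equations. In the frame block the
  commutator of two skew matrices is skew, so the six entries above the diagonal determine the
  others.\<close>

lemma frame_coeff_compat:
  assumes "smooth_on S k1" "smooth_on S k2" "smooth_on S k3" "smooth_on S k4" "smooth_on S k5" "smooth_on S k6"
    and "smooth_on S m1" "smooth_on S m2" "smooth_on S m3" "smooth_on S m4" "smooth_on S m5" "smooth_on S m6"
    and "p \<in> S"
    and "pv e1 p - e2 p * m1 p = pu f1 p - f2 p * k1 p"
    and "pv e2 p + e1 p * m1 p = pu f2 p + f1 p * k1 p"
    and "e1 p * m2 p + e2 p * m4 p = f1 p * k2 p + f2 p * k4 p"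
    and "e1 p * m3 p + e2 p * m5 p = f1 p * k3 p + f2 p * k5 p"
    and "pv k1 p - k2 p * m4 p - k3 p * m5 p = pu m1 p - m2 p * k4 p - m3 p * k5 p"
    and "pv k2 p + k1 p * m4 p - k3 p * m6 p = pu m2 p + m1 p * k4 p - m3 p * k6 p"
    and "pv k3 p + k1 p * m5 p + k2 p * m6 p = pu m3 p + m1 p * k5 p + m2 p * k6 p"
    and "pv k4 p - k1 p * m2 p - k5 p * m6 p = pu m4 p - m1 p * k2 p - m5 p * k6 p"
    and "pv k5 p - k1 p * m3 p + k4 p * m6 p = pu m5 p - m1 p * k3 p + m4 p * k6 p"
    and "pv k6 p - k2 p * m3 p - k4 p * m5 p = pu m6 p - m2 p * k3 p - m4 p * k5 p"
  shows "pv (frame_coeff e1 e2 k1 k2 k3 k4 k5 k6 i j) p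
      + (\<Sum>n\<in>UNIV. frame_coeff e1 e2 k1 k2 k3 k4 k5 k6 i n p * frame_coeff f1 f2 m1 m2 m3 m4 m5 m6 n j p)
    = pu (frame_coeff f1 f2 m1 m2 m3 m4 m5 m6 i j) p
      + (\<Sum>n\<in>UNIV. frame_coeff f1 f2 m1 m2 m3 m4 m5 m6 i n p * frame_coeff e1 e2 k1 k2 k3 k4 k5 k6 n j p)"
  using assms(14-)
  by (cases i; cases j)
    (simp_all add: UNIV_slot pu_uminus[OF assms(7,13)] pu_uminus[OF assms(8,13)] pu_uminus[OF assms(9,13)]
      pu_uminus[OF assms(10,13)] pu_uminus[OF assms(11,13)] pu_uminus[OF assms(12,13)]
      pv_uminus[OF assms(1,13)] pv_uminus[OF assms(2,13)] pv_uminus[OF assms(3,13)]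
      pv_uminus[OF assms(4,13)] pv_uminus[OF assms(5,13)] pv_uminus[OF assms(6,13)] algebra_simps)

lemma scaleR_inverse_eq_iff: "s > 0 \<Longrightarrow> (1 / s) *\<^sub>R a = w \<longleftrightarrow> a = s *\<^sub>R (w :: 'v::real_vector)"
  by auto

section \<open>Construction and uniqueness of the surface\<close>

theorem theorem4p1:
  fixes D :: "(real \<times> real) set"
    and g1 g2 n1 n2 lam mu b1 b2 sE sG :: "real \<times> real \<Rightarrow> real"
    and u0 v0 :: real and p0 x0 y0 b0 l0 :: "real^4"
  assumes D: "open D" "connected D" "(u0, v0) \<in> D"
    and smooth: "smooth_on D g1" "smooth_on D g2" "smooth_on D n1" "smooth_on D n2"
      "smooth_on D lam" "smooth_on D mu" "smooth_on D b1" "smooth_on D b2"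
    and sE_def: "\<forall>p\<in>D. sE p = pu mu p / (2 * mu p * g2 p + n1 p * b2 p - lam p * b1 p)"
    and sG_def: "\<forall>p\<in>D. sG p = pv mu p / (2 * mu p * g1 p - lam p * b2 p + n2 p * b1 p)"
    and pos: "\<forall>p\<in>D. sE p > 0 \<and> sG p > 0"
    and eq1: "\<forall>p\<in>D. - g1 p * sE p * sG p = pv sE p"
    and eq2: "\<forall>p\<in>D. - g2 p * sE p * sG p = pu sG p"
    and eq3: "\<forall>p\<in>D. n1 p * n2 p - ((lam p)\<^sup>2 + (mu p)\<^sup>2)
                 = pu g2 p / sE p + pv g1 p / sG p - ((g1 p)\<^sup>2 + (g2 p)\<^sup>2)"
    and eq4: "\<forall>p\<in>D. 2 * lam p * g2 p + mu p * b1 p - (n1 p - n2 p) * g1 p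
                 = pu lam p / sE p - pv n1 p / sG p"
    and eq5: "\<forall>p\<in>D. 2 * lam p * g1 p + mu p * b2 p + (n1 p - n2 p) * g2 p
                 = - pu n2 p / sE p + pv lam p / sG p"
    and eq6: "\<forall>p\<in>D. g1 p * b1 p - g2 p * b2 p + (n1 p - n2 p) * mu p
                 = - pu b2 p / sE p + pv b1 p / sG p"
    and frame0: "orthonormal4 x0 y0 b0 l0"
  shows "\<exists>D0. open D0 \<and> connected D0 \<and> D0 \<subseteq> D \<and> (u0, v0) \<in> D0 \<and>
    (let Surf = (\<lambda>z :: real \<times> real \<Rightarrow> real^4.
        smooth_on D0 z \<and> z (u0, v0) = p0 \<and>
        (\<forall>p\<in>D0. pu z p \<bullet> pu z p = (sE p)\<^sup>2 \<and> pu z p \<bullet> pv z p = 0 \<and> pv z p \<bullet> pv z p = (sG p)\<^sup>2) \<and>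
        (\<exists>x y b l :: real \<times> real \<Rightarrow> real^4.
           smooth_on D0 x \<and> smooth_on D0 y \<and> smooth_on D0 b \<and> smooth_on D0 l \<and>
           x (u0, v0) = x0 \<and> y (u0, v0) = y0 \<and> b (u0, v0) = b0 \<and> l (u0, v0) = l0 \<and>
           (\<forall>p\<in>D0.
              x p = (1 / sE p) *\<^sub>R pu z p \<and> y p = (1 / sG p) *\<^sub>R pv z p \<and>
              orthonormal4 (x p) (y p) (b p) (l p) \<and>
              (1 / sE p) *\<^sub>R pu x p = g1 p *\<^sub>R y p + n1 p *\<^sub>R b p \<and>
              (1 / sE p) *\<^sub>R pu y p = - g1 p *\<^sub>R x p + lam p *\<^sub>R b p + mu p *\<^sub>R l p \<and>
              (1 / sG p) *\<^sub>R pv x p = - g2 p *\<^sub>R y p + lam p *\<^sub>R b p + mu p *\<^sub>R l p \<and>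
              (1 / sG p) *\<^sub>R pv y p = g2 p *\<^sub>R x p + n2 p *\<^sub>R b p \<and>
              (1 / sE p) *\<^sub>R pu b p = - n1 p *\<^sub>R x p - lam p *\<^sub>R y p + b1 p *\<^sub>R l p \<and>
              (1 / sG p) *\<^sub>R pv b p = - lam p *\<^sub>R x p - n2 p *\<^sub>R y p + b2 p *\<^sub>R l p \<and>
              (1 / sE p) *\<^sub>R pu l p = - mu p *\<^sub>R y p - b1 p *\<^sub>R b p \<and>
              (1 / sG p) *\<^sub>R pv l p = - mu p *\<^sub>R x p - b2 p *\<^sub>R b p)))
     in \<exists>z. Surf z \<and> (\<forall>z'. Surf z' \<longrightarrow> (\<forall>p\<in>D0. z' p = z p)))"
proof -
  let ?M = "\<lambda>p. 2 * mu p * g2 p + n1 p * b2 p - lam p * b1 p"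
  let ?N = "\<lambda>p. 2 * mu p * g1 p - lam p * b2 p + n2 p * b1 p"
  \<comment> \<open>Division by 0 yields 0, so positivity of the two quotients excludes a vanishing
    denominator.\<close>
  have nz: "?M p \<noteq> 0" "?N p \<noteq> 0" if "p \<in> D" for p
    using bspec[OF sE_def that] bspec[OF sG_def that] bspec[OF pos that] by (auto simp del: divide_eq_0_iff)
  note sm = smooth_on_mult[OF D(1)] smooth_on_uminus[OF D(1)]
  have sE: "smooth_on D sE"
    by (rule smooth_on_cong[OF D(1) bspec[OF sE_def, symmetric]], assumption)
      (intro smooth_on_divide smooth_on_add smooth_on_diff sm smooth_on_pu smooth smooth_on_const D(1) nz; assumption)
  have sG: "smooth_on D sG"
    by (rule smooth_on_cong[OF D(1) bspec[OF sG_def, symmetric]], assumption)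
      (intro smooth_on_divide smooth_on_add smooth_on_diff sm smooth_on_pv smooth smooth_on_const D(1) nz; assumption)
  \<comment> \<open>These are the claimed formulas multiplied by \<open>sE\<close> and
    \<open>sG\<close>. The zero for \<open>k3\<close> in \<open>?A\<close> and for \<open>k5\<close>
    in \<open>?B\<close> says that \<open>x_u\<close> and \<open>y_v\<close> have no component along
    \<open>l\<close>, that is, the normal parts of \<open>x_u\<close> and \<open>y_v\<close> are
    collinear with \<open>b\<close>.\<close>
  let ?A = "frame_coeff sE (\<lambda>p. 0) (\<lambda>p. sE p * g1 p) (\<lambda>p. sE p * n1 p) (\<lambda>p. 0)
    (\<lambda>p. sE p * lam p) (\<lambda>p. sE p * mu p) (\<lambda>p. sE p * b1 p)"
  let ?B = "frame_coeff (\<lambda>p. 0) sG (\<lambda>p. - (sG p * g2 p)) (\<lambda>p. sG p * lam p) (\<lambda>p. sG p * mu p)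
    (\<lambda>p. sG p * n2 p) (\<lambda>p. 0) (\<lambda>p. sG p * b2 p)"
  note smE = smooth_on_mult[OF D(1) sE] and smG = smooth_on_mult[OF D(1) sG]
  have A: "smooth_on D (?A i j)" for i j
    by (intro smooth_on_frame_coeff D(1) smooth_on_const sE smE smooth)
  have B: "smooth_on D (?B i j)" for i j
    by (intro smooth_on_frame_coeff D(1) smooth_on_const sG smG smooth smooth_on_uminus)
  \<comment> \<open>In the row \<open>Pos\<close>, \<open>eq1\<close> and \<open>eq2\<close> are the
    entries \<open>FX\<close> and \<open>FY\<close>, and the entries \<open>FB\<close> and
    \<open>FL\<close> are identities reflecting the symmetry of the second fundamental form. In the
    frame block, \<open>eq3\<close> (Gauss) is the entry xy, \<open>eq4\<close> and
    \<open>eq5\<close> (Codazzi) are xb and yb, the formulas for \<open>pu mu\<close> and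
    \<open>pv mu\<close> are xl and yl, and \<open>eq6\<close> (Ricci) is bl. Only
    \<open>pv sE\<close> and \<open>pu sG\<close> arise from the product rule, and
    \<open>eq1\<close>, \<open>eq2\<close> eliminate them.\<close>
  have compat: "pv (?A i j) p + (\<Sum>n\<in>UNIV. ?A i n p * ?B n j p)
      = pu (?B i j) p + (\<Sum>n\<in>UNIV. ?B i n p * ?A n j p)" if p: "p \<in> D" for i j p
  proof -
    have E: "sE p > 0" and G: "sG p > 0" using pos p by auto
    have pv_E: "pv (\<lambda>p. sE p * f p) p = sE p * pv f p - g1 p * sE p * sG p * f p" if "smooth_on D f" for f
      using pv_mult[OF sE that p] by (simp add: bspec[OF eq1 p, symmetric])
    have pu_G: "pu (\<lambda>p. sG p * f p) p = sG p * pu f p - g2 p * sE p * sG p * f p" if "smooth_on D f" for f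
      using pu_mult[OF sG that p] by (simp add: bspec[OF eq2 p, symmetric])
    have pu_neg: "pu (\<lambda>p. - (sG p * g2 p)) p = - (sG p * pu g2 p - g2 p * sE p * sG p * g2 p)"
      using pu_uminus[OF smG[OF smooth(2)] p] pu_G[OF smooth(2)] by simp
    have mu_u: "pu mu p = sE p * ?M p"
      using bspec[OF sE_def p] nz(1)[OF p] by (simp add: field_simps)
    have mu_v: "pv mu p = sG p * ?N p"
      using bspec[OF sG_def p] nz(2)[OF p] by (simp add: field_simps)
    \<comment> \<open>Multiplying the conditions by \<open>sE * sG\<close> clears the denominators,
      so that each entry becomes a linear consequence after expansion into monomials.\<close>
    have c3: "sE p * sG p * (n1 p * n2 p - (lam p * lam p + mu p * mu p))
        = sG p * pu g2 p + sE p * pv g1 p - sE p * sG p * (g1 p * g1 p + g2 p * g2 p)"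
      unfolding bspec[OF eq3 p, unfolded power2_eq_square] using E G by (simp add: field_simps)
    have c4: "sE p * sG p * (2 * lam p * g2 p + mu p * b1 p - (n1 p - n2 p) * g1 p)
        = sG p * pu lam p - sE p * pv n1 p"
      unfolding bspec[OF eq4 p] using E G by (simp add: field_simps)
    have c5: "sE p * sG p * (2 * lam p * g1 p + mu p * b2 p + (n1 p - n2 p) * g2 p)
        = - sG p * pu n2 p + sE p * pv lam p"
      unfolding bspec[OF eq5 p] using E G by (simp add: field_simps)
    have c6: "sE p * sG p * (g1 p * b1 p - g2 p * b2 p + (n1 p - n2 p) * mu p)
        = - sG p * pu b2 p + sE p * pv b1 p"
      unfolding bspec[OF eq6 p] using E G by (simp add: field_simps)
    show ?thesis
      by (rule frame_coeff_compat[where S = D];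
          ((intro smE smG smooth smooth_on_const smooth_on_uminus D(1) p)?);
          (use bspec[OF eq1 p] bspec[OF eq2 p] c3 c4 c5 c6 in
            \<open>(simp only: pv_E pu_G pu_neg smooth mu_u mu_v)?, simp add: algebra_simps\<close>))
  qed
  obtain r F where r: "r > 0" and SD: "{u0 - r<..<u0 + r} \<times> {v0 - r<..<v0 + r} \<subseteq> D"
    and F0: "\<And>i. F i (u0, v0) = (case i of Pos \<Rightarrow> p0 | FX \<Rightarrow> x0 | FY \<Rightarrow> y0 | FB \<Rightarrow> b0 | FL \<Rightarrow> l0)"
    and smF: "\<And>i. smooth_on ({u0 - r<..<u0 + r} \<times> {v0 - r<..<v0 + r}) (F i)"
    and Fu: "\<And>i u v. (u, v) \<in> {u0 - r<..<u0 + r} \<times> {v0 - r<..<v0 + r} \<Longrightarrow>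
       ((\<lambda>t. F i (t, v)) has_vector_derivative (\<Sum>j\<in>UNIV. ?A i j (u, v) *\<^sub>R F j (u, v))) (at u)"
    and Fv: "\<And>i u v. (u, v) \<in> {u0 - r<..<u0 + r} \<times> {v0 - r<..<v0 + r} \<Longrightarrow>
       ((\<lambda>t. F i (u, t)) has_vector_derivative (\<Sum>j\<in>UNIV. ?B i j (u, v) *\<^sub>R F j (u, v))) (at v)"
    by (rule linear_pfaffian_system_local[OF D(1,3) A B compat,
          where ?w0.0 = "\<lambda>i. case i of Pos \<Rightarrow> p0 | FX \<Rightarrow> x0 | FY \<Rightarrow> y0 | FB \<Rightarrow> b0 | FL \<Rightarrow> l0"];
        (assumption | (rule that; assumption)))
  define S where "S = {u0 - r<..<u0 + r} \<times> {v0 - r<..<v0 + r}"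
  note SD = SD[folded S_def] and smF = smF[folded S_def] and Fu = Fu[folded S_def] and Fv = Fv[folded S_def]
  note const = constant_on_rectangle[where a = "u0 - r" and b = "u0 + r" and a' = "v0 - r" and b' = "v0 + r",
      folded S_def]
  have S: "open S" "connected S" "(u0, v0) \<in> S"
    using r unfolding S_def by (auto intro: open_Times connected_Times)
  have EG: "sE p > 0" "sG p > 0" if "p \<in> S" for p using pos SD that by auto
  define z x y b l where "z = F Pos" and "x = F FX" and "y = F FY" and "b = F FB" and "l = F FL"
  note fdefs = z_def x_def y_def b_def l_def
  have sm: "smooth_on S z" "smooth_on S x" "smooth_on S y" "smooth_on S b" "smooth_on S l"
    unfolding fdefs by (rule smF)+
  have init: "z (u0, v0) = p0" "x (u0, v0) = x0" "y (u0, v0) = y0" "b (u0, v0) = b0" "l (u0, v0) = l0"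
    by (simp_all add: fdefs F0)
  let ?ode_u = "\<lambda>x y b l u v. frenet_ode (\<lambda>t. x (t, v)) (\<lambda>t. y (t, v)) (\<lambda>t. b (t, v)) (\<lambda>t. l (t, v)) u
    (sE (u, v) * g1 (u, v)) (sE (u, v) * n1 (u, v)) 0
    (sE (u, v) * lam (u, v)) (sE (u, v) * mu (u, v)) (sE (u, v) * b1 (u, v))"
  let ?ode_v = "\<lambda>x y b l u v. frenet_ode (\<lambda>t. x (u, t)) (\<lambda>t. y (u, t)) (\<lambda>t. b (u, t)) (\<lambda>t. l (u, t)) v
    (- (sG (u, v) * g2 (u, v))) (sG (u, v) * lam (u, v)) (sG (u, v) * mu (u, v))
    (sG (u, v) * n2 (u, v)) 0 (sG (u, v) * b2 (u, v))"
  have ode: "?ode_u x y b l u v" "?ode_v x y b l u v" if "(u, v) \<in> S" for u v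
    unfolding frenet_ode_def fdefs
    by (intro conjI has_vector_derivative_eq_rhs[OF Fu[OF that]] has_vector_derivative_eq_rhs[OF Fv[OF that]];
        simp add: UNIV_slot algebra_simps)+
  have zuv: "pu z p = sE p *\<^sub>R x p" "pv z p = sG p *\<^sub>R y p" if "p \<in> S" for p
  proof -
    obtain u v where p: "p = (u, v)" by (cases p)
    have "((\<lambda>t. z (t, v)) has_vector_derivative sE p *\<^sub>R x p) (at u)"
      "((\<lambda>t. z (u, t)) has_vector_derivative sG p *\<^sub>R y p) (at v)"
      using Fu[OF that[unfolded p], of Pos] Fv[OF that[unfolded p], of Pos]
      by (simp_all add: fdefs UNIV_slot p)
    then show "pu z p = sE p *\<^sub>R x p" "pv z p = sG p *\<^sub>R y p"
      unfolding p by (simp_all add: pu_eqI pv_eqI)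
  qed
  have frame: "orthonormal4 (x p) (y p) (b p) (l p)" if "p \<in> S" for p
  proof -
    have "gram_defect (x p) (y p) (b p) (l p)
        = gram_defect (x (u0, v0)) (y (u0, v0)) (b (u0, v0)) (l (u0, v0))"
      by (rule const[where f = "\<lambda>p. gram_defect (x p) (y p) (b p) (l p)"])
        (use that S(3) in \<open>auto intro: frenet_ode_gram_defect[OF ode(1)] frenet_ode_gram_defect[OF ode(2)]\<close>)
    also have "\<dots> = 0" using frame0 by (simp add: init gram_defect_eq_0_iff)
    finally show ?thesis by (simp add: gram_defect_eq_0_iff)
  qed
  have first_form: "pu z p \<bullet> pu z p = (sE p)\<^sup>2 \<and> pu z p \<bullet> pv z p = 0 \<and> pv z p \<bullet> pv z p = (sG p)\<^sup>2"
    if "p \<in> S" for p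
    using frame[OF that] by (simp add: zuv[OF that] orthonormal4_def power2_eq_square)
  let ?frenet = "\<lambda>x y b l p.
    (1 / sE p) *\<^sub>R pu x p = g1 p *\<^sub>R y p + n1 p *\<^sub>R b p \<and>
    (1 / sE p) *\<^sub>R pu y p = - g1 p *\<^sub>R x p + lam p *\<^sub>R b p + mu p *\<^sub>R l p \<and>
    (1 / sG p) *\<^sub>R pv x p = - g2 p *\<^sub>R y p + lam p *\<^sub>R b p + mu p *\<^sub>R l p \<and>
    (1 / sG p) *\<^sub>R pv y p = g2 p *\<^sub>R x p + n2 p *\<^sub>R b p \<and>
    (1 / sE p) *\<^sub>R pu b p = - n1 p *\<^sub>R x p - lam p *\<^sub>R y p + b1 p *\<^sub>R l p \<and>
    (1 / sG p) *\<^sub>R pv b p = - lam p *\<^sub>R x p - n2 p *\<^sub>R y p + b2 p *\<^sub>R l p \<and>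
    (1 / sE p) *\<^sub>R pu l p = - mu p *\<^sub>R y p - b1 p *\<^sub>R b p \<and>
    (1 / sG p) *\<^sub>R pv l p = - mu p *\<^sub>R x p - b2 p *\<^sub>R b p"
  \<comment> \<open>For smooth frames the eight displayed formulas are the two skew systems divided
    by \<open>sE\<close> and \<open>sG\<close>. Existence uses one direction of the equivalence and
    uniqueness the other.\<close>
  have frenet_iff: "?frenet x' y' b' l' (u, v) \<longleftrightarrow> ?ode_u x' y' b' l' u v \<and> ?ode_v x' y' b' l' u v"
    if uv: "(u, v) \<in> S" and sm': "smooth_on S x'" "smooth_on S y'" "smooth_on S b'" "smooth_on S l'"
    for u v and x' y' b' l' :: "real \<times> real \<Rightarrow> real^4"
  proof -
    have du: "((\<lambda>t. f (t, v)) has_vector_derivative d) (at u) \<longleftrightarrow> pu f (u, v) = d"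
      and dv: "((\<lambda>t. f (u, t)) has_vector_derivative d) (at v) \<longleftrightarrow> pv f (u, v) = d"
      if "smooth_on S f" for f :: "real \<times> real \<Rightarrow> real^4" and d
      using smooth_on_has_pu[OF that uv] smooth_on_has_pv[OF that uv] pu_eqI pv_eqI by metis+
    show ?thesis
      unfolding frenet_ode_def scaleR_inverse_eq_iff[OF EG(1)[OF uv]] scaleR_inverse_eq_iff[OF EG(2)[OF uv]]
        du[OF sm'(1)] du[OF sm'(2)] du[OF sm'(3)] du[OF sm'(4)]
        dv[OF sm'(1)] dv[OF sm'(2)] dv[OF sm'(3)] dv[OF sm'(4)]
      by (simp add: algebra_simps) blast
  qed
  have unique: "z' p = z p"
    if sm': "smooth_on S z'" "smooth_on S x'" "smooth_on S y'" "smooth_on S b'" "smooth_on S l'"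
      and init': "z' (u0, v0) = p0" "x' (u0, v0) = x0" "y' (u0, v0) = y0" "b' (u0, v0) = b0" "l' (u0, v0) = l0"
      and eqs: "\<And>p. p \<in> S \<Longrightarrow> x' p = (1 / sE p) *\<^sub>R pu z' p \<and> y' p = (1 / sG p) *\<^sub>R pv z' p
        \<and> ?frenet x' y' b' l' p"
      and p: "p \<in> S"
    for z' x' y' b' l' :: "real \<times> real \<Rightarrow> real^4" and p
  proof -
    \<comment> \<open>The difference of the two frames solves the same skew systems and vanishes at
      the base point, so its energy is 0 on the whole square. Equal frames give \<open>z'\<close>
      and \<open>z\<close> equal partial derivatives, and the common value \<open>p0\<close> makes
      the surfaces coincide.\<close>
    let ?E = "\<lambda>p. frame_energy (x' p - x p) (y' p - y p) (b' p - b p) (l' p - l p)"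
    have ode': "?ode_u x' y' b' l' u v" "?ode_v x' y' b' l' u v" if "(u, v) \<in> S" for u v
      using frenet_iff[OF that sm'(2-5)] eqs[OF that] by blast+
    have xy: "x' q = x q \<and> y' q = y q" if "q \<in> S" for q
    proof -
      have "?E q = ?E (u0, v0)"
        by (rule const[where f = ?E])
          (use that S(3) in \<open>auto intro: frenet_ode_frame_energy[OF frenet_ode_diff[OF ode'(1) ode(1)]]
            frenet_ode_frame_energy[OF frenet_ode_diff[OF ode'(2) ode(2)]]\<close>)
      also have "\<dots> = 0" by (simp add: init init' frame_energy_eq_0_iff)
      finally show ?thesis by (simp add: frame_energy_eq_0_iff)
    qed
    have same: "pu z' q = pu z q" "pv z' q = pv z q" if "q \<in> S" for q
      using eqs[OF that] xy[OF that] zuv[OF that] EG[OF that] by (auto simp: scaleR_inverse_eq_iff)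
    have "z' p - z p = z' (u0, v0) - z (u0, v0)"
    proof (rule const[where f = "\<lambda>p. z' p - z p"])
      fix u v assume uv: "(u, v) \<in> S"
      show "((\<lambda>t. z' (t, v) - z (t, v)) has_vector_derivative 0) (at u)"
        using has_vector_derivative_diff[OF smooth_on_has_pu[OF sm'(1) uv] smooth_on_has_pu[OF sm(1) uv]]
        by (simp add: same[OF uv])
      show "((\<lambda>t. z' (u, t) - z (u, t)) has_vector_derivative 0) (at v)"
        using has_vector_derivative_diff[OF smooth_on_has_pv[OF sm'(1) uv] smooth_on_has_pv[OF sm(1) uv]]
        by (simp add: same[OF uv])
    qed (use p S(3) in auto)
    then show ?thesis by (simp add: init init')
  qed
  have exists: "x p = (1 / sE p) *\<^sub>R pu z p \<and> y p = (1 / sG p) *\<^sub>R pv z p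
      \<and> orthonormal4 (x p) (y p) (b p) (l p) \<and> ?frenet x y b l p" if "p \<in> S" for p
    using frame[OF that] zuv[OF that] EG[OF that] frenet_iff[of "fst p" "snd p", OF _ sm(2-5)] ode[of "fst p" "snd p"] that
    by simp
  show ?thesis
    unfolding Let_def
  proof (rule exI[of _ S], intro conjI S SD, rule exI[of _ z], intro conjI allI impI ballI)
    show "\<exists>x y b l :: real \<times> real \<Rightarrow> real^4.
       smooth_on S x \<and> smooth_on S y \<and> smooth_on S b \<and> smooth_on S l \<and>
       x (u0, v0) = x0 \<and> y (u0, v0) = y0 \<and> b (u0, v0) = b0 \<and> l (u0, v0) = l0 \<and>
       (\<forall>p\<in>S. x p = (1 / sE p) *\<^sub>R pu z p \<and> y p = (1 / sG p) *\<^sub>R pv z p \<and>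
          orthonormal4 (x p) (y p) (b p) (l p) \<and> ?frenet x y b l p)"
      using sm init exists by blast
  next
    fix z' p
    assume "smooth_on S z' \<and> z' (u0, v0) = p0 \<and>
      (\<forall>p\<in>S. pu z' p \<bullet> pu z' p = (sE p)\<^sup>2 \<and> pu z' p \<bullet> pv z' p = 0 \<and> pv z' p \<bullet> pv z' p = (sG p)\<^sup>2) \<and>
      (\<exists>x y b l :: real \<times> real \<Rightarrow> real^4.
       smooth_on S x \<and> smooth_on S y \<and> smooth_on S b \<and> smooth_on S l \<and>
       x (u0, v0) = x0 \<and> y (u0, v0) = y0 \<and> b (u0, v0) = b0 \<and> l (u0, v0) = l0 \<and>
       (\<forall>p\<in>S. x p = (1 / sE p) *\<^sub>R pu z' p \<and> y p = (1 / sG p) *\<^sub>R pv z' p \<and>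
          orthonormal4 (x p) (y p) (b p) (l p) \<and> ?frenet x y b l p))" and p: "p \<in> S"
    then obtain x' y' b' l' where "smooth_on S z'" "smooth_on S x'" "smooth_on S y'" "smooth_on S b'"
        "smooth_on S l'" "z' (u0, v0) = p0" "x' (u0, v0) = x0" "y' (u0, v0) = y0" "b' (u0, v0) = b0"
        "l' (u0, v0) = l0" "\<And>p. p \<in> S \<Longrightarrow> x' p = (1 / sE p) *\<^sub>R pu z' p \<and> y' p = (1 / sG p) *\<^sub>R pv z' p
        \<and> ?frenet x' y' b' l' p"
      by blast
    from unique[OF this p] show "z' p = z p" .
  qed (use sm(1) init(1) first_form in auto)
qed

end
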